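(* Let $\mathcal H$ and $\mathcal G$ be real Hilbert spaces, $f\in\Gamma(\mathcal H)$, $g\in\Gamma(\mathcal G)$, and $L:\mathcal H\to\mathcal G$ a linear continuous operator. Consider the primal problem $$(P)\quad \inf_{x\in\mathcal H}\{f(x)+g(Lx)\}$$ and its Fenchel-type dual $$(D)\quad \sup_{v\in\mathcal G}\{-f^*(-L^*v)-g^*(v)\},$$ with optimal objective values $v(P)$ and $v(D)$, respectively. Suppose that $(P)$ has an optimal solution, that $0\in\operatorname{sqri}(\operatorname{dom} g-L(\operatorname{dom} f))$, and that there exists $\theta>0$ such that $\|Lx\|\ge\theta\|x\|$ for all $x\in\mathcal H$. Let $y^0,y^1,z^0,z^1\in\mathcal G$, $\gamma>0$, let $(\alpha_k)_{k\ge1}$ be a nondecreasing real sequence with $0\le\alpha_k\le\alpha<1$ for every $k\ge2$, and let $(\lambda_k)_{k\ge1}$ be a real sequence and $\lambda,\sigma,\delta>0$ be such that $$\delta>\frac{\alpha^2(1+\alpha)+\alpha\sigma}{1-\alpha^2}\quad\text{and}\quad 0<\lambda\le\lambda_k\le 2\cdot\frac{\delta-\alpha[\alpha(1+\alpha)+\alpha\delta+\sigma]}{\delta[1+\alpha(1+\alpha)+\alpha\delta+\sigma]}\quad\forall k\ge2.$$ Suppose that either $\alpha_2=0$ or $\lambda_1=\alpha_1=0$. For every $k\ge1$ define $$x^{k+1}=\operatorname*{argmin}_{x\in\mathcal H}\Big\{f(x)+\big\langle y^k-\alpha_k(y^k-y^{k-1})-\gamma\alpha_k(z^k-z^{k-1}),Lx\big\rangle+\tfrac{\gamma}{2}\|Lx-z^k\|^2\Big\},$$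 $$\overline z^{k+1}=\alpha_{k+1}\lambda_k(Lx^{k+1}-z^k)+\frac{(1-\lambda_k)\alpha_k\alpha_{k+1}}{\gamma}\big(y^k-y^{k-1}+\gamma(z^k-z^{k-1})\big),$$ $$z^{k+1}=\operatorname*{argmin}_{z\in\mathcal G}\Big\{g(z+\overline z^{k+1})+\big\langle -y^k-(1-\lambda_k)\alpha_k\big(y^k-y^{k-1}+\gamma(z^k-z^{k-1})\big),z\big\rangle+\tfrac{\gamma}{2}\|z-\lambda_kLx^{k+1}-(1-\lambda_k)z^k\|^2\Big\},$$ $$y^{k+1}=y^k+\gamma\big(\lambda_kLx^{k+1}+(1-\lambda_k)z^k-z^{k+1}\big)+(1-\lambda_k)\alpha_k\big(y^k-y^{k-1}+\gamma(z^k-z^{k-1})\big).$$ Then there exists $(\overline x,\overline v)\in\mathcal H\times\mathcal G$ satisfying $$-L^*\overline v\in\partial f(\overline x)\quad\text{and}\quad \overline v\in\partial g(L\overline x)$$ (hence $\overline x$ is an optimal solution to $(P)$, $\overline v$ is an optimal solution to $(D)$ and $v(P)=v(D)$), such that the following statements are true: (i) $(x^k)_{k\ge2}$ converges weakly to $\overline x$; (ii) $(\overline z^k)_{k\ge2}$ converges strongly to $0$; (iii) $(z^k)_{k\in\mathbb N}$ converges weakly to $L\overline x$; (iv) $(Lx^{k+1}-z^k)_{k\ge2}$ converges strongly to $0$; (v) $(y^k)_{k\in\mathbb N}$ converges weakly to $\overline v$; (vi) if $g^*$ is uniformly convex, then $(y^k)_{k\in\mathbb N}$ converges strongly to the unique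 optimal solution of $(D)$; (vii) $\lim_{k\to+\infty}\big(f(x^{k+1})+g(z^k+\overline z^k)\big)=v(P)=v(D)=\lim_{k\to+\infty}\big(-f^*(-L^*v^k)-g^*(y^k)\big)$, where the sequence $(v^k)_{k\ge1}$ is defined by $$v^k=y^k-\gamma z^k+\gamma Lx^{k+1}-\alpha_k\big(y^k-y^{k-1}+\gamma(z^k-z^{k-1})\big)\quad\forall k\ge1,$$ and $(v^k)_{k\ge1}$ converges weakly to $\overline v$.
   Context: $\Gamma(\mathcal H)$ denotes the family of proper, convex, lower semicontinuous functions $\mathcal H\to\mathbb R\cup\{\pm\infty\}$ (proper: never $-\infty$ and not identically $+\infty$). $\operatorname{dom} f=\{x: f(x)<+\infty\}$; $f^*(u)=\sup_{x}\{\langle u,x\rangle-f(x)\}$ is the conjugate; $\partial f(x)=\{v: f(y)\ge f(x)+\langle v,y-x\rangle\ \forall y\}$ if $f(x)\in\mathbb R$ and $\partial f(x)=\varnothing$ otherwise. $L^*:\mathcal G\to\mathcal H$ is the adjoint of $L$. $\mathbb N=\{0,1,2,\dots\}$. For a convex set $S\subseteq\mathcal G$, the strong quasi-relative interior is $\operatorname{sqri}S=\{x\in S:\bigcup_{\lambda>0}\lambda(S-x)\text{ is a closed linear subspace of }\mathcal G\}$. A proper function $h$ is uniformly convex if there is an increasing function $\phi:[0,+\infty)\to[0,+\infty]$ vanishing only at $0$ such that $h(tx+(1-t)y)+t(1-t)\phi(\|x-y\|)\le th(x)+(1-t)h(y)$ for all $x,y\in\operatorname{dom}h$ and $t\in(0,1)$.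 The condition $\|Lx\|\ge\theta\|x\|$ makes the objective function defining $x^{k+1}$ strongly convex, and the objective function defining $z^{k+1}$ is strongly convex, so both minimizers exist and are unique. *)

theory Defs
  imports "HOL-Analysis.Analysis"
begin

text \<open>
  Hilbert spaces are types of sort \<open>{real_inner, complete_space}\<close>; no countability or dimension
  restriction is involved, and the zero space is allowed.
\<close>

definition eff_dom :: "('a \<Rightarrow> ereal) \<Rightarrow> 'a set" where
  "eff_dom f = {x. f x < \<infinity>}"

definition proper_fun :: "('a \<Rightarrow> ereal) \<Rightarrow> bool" where
  "proper_fun f \<longleftrightarrow> (\<forall>x. f x \<noteq> -\<infinity>) \<and> (\<exists>x. f x \<noteq> \<infinity>)"

text \<open>
  On \<open>ereal\<close> one has \<open>\<infinity> + (-\<infinity>) = \<infinity>\<close>, the usual convention for convex functions.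
\<close>

definition convex_fun :: "('a::real_vector \<Rightarrow> ereal) \<Rightarrow> bool" where
  "convex_fun f \<longleftrightarrow>
     (\<forall>x y. \<forall>t\<in>{0<..<1}. f (t *\<^sub>R x + (1 - t) *\<^sub>R y) \<le> ereal t * f x + ereal (1 - t) * f y)"

definition lsc_fun :: "('a::topological_space \<Rightarrow> ereal) \<Rightarrow> bool" where
  "lsc_fun f \<longleftrightarrow> (\<forall>x. f x \<le> Liminf (nhds x) f)"

definition Gamma_class :: "('a::real_normed_vector \<Rightarrow> ereal) set" where
  "Gamma_class = {f. proper_fun f \<and> convex_fun f \<and> lsc_fun f}"

definition conj_fun :: "('a::real_inner \<Rightarrow> ereal) \<Rightarrow> 'a \<Rightarrow> ereal" where
  "conj_fun f u = (SUP x. ereal (u \<bullet> x) - f x)"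

definition subdiff :: "('a::real_inner \<Rightarrow> ereal) \<Rightarrow> 'a \<Rightarrow> 'a set" where
  "subdiff f x =
     (if \<bar>f x\<bar> \<noteq> \<infinity> then {v. \<forall>y. f y \<ge> f x + ereal (v \<bullet> (y - x))} else {})"

definition sqri :: "'a::real_normed_vector set \<Rightarrow> 'a set" where
  "sqri S =
     {x \<in> S. subspace (\<Union>l\<in>{0<..}. {l *\<^sub>R (s - x) | s. s \<in> S})
           \<and> closed (\<Union>l\<in>{0<..}. {l *\<^sub>R (s - x) | s. s \<in> S})}"

text \<open>The modulus \<open>\<phi>\<close> is only relevant on \<open>[0, \<infinity>)\<close>; increasing is meant in the non-strict sense.\<close>

definition uniformly_convex_fun :: "('a::real_normed_vector \<Rightarrow> ereal) \<Rightarrow> bool" where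
  "uniformly_convex_fun h \<longleftrightarrow> proper_fun h \<and>
     (\<exists>\<phi> :: real \<Rightarrow> ereal.
        mono_on {0..} \<phi> \<and> (\<forall>s\<ge>0. 0 \<le> \<phi> s \<and> (\<phi> s = 0 \<longleftrightarrow> s = 0)) \<and>
        (\<forall>x\<in>eff_dom h. \<forall>y\<in>eff_dom h. \<forall>t\<in>{0<..<1}.
           h (t *\<^sub>R x + (1 - t) *\<^sub>R y) + ereal (t * (1 - t)) * \<phi> (norm (x - y))
             \<le> ereal t * h x + ereal (1 - t) * h y))"

definition weakly_converges :: "(nat \<Rightarrow> 'a::real_inner) \<Rightarrow> 'a \<Rightarrow> bool" where
  "weakly_converges X l \<longleftrightarrow> (\<forall>u. (\<lambda>k. X k \<bullet> u) \<longlonglongrightarrow> l \<bullet> u)"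

definition primal_obj ::
  "('h \<Rightarrow> ereal) \<Rightarrow> ('g \<Rightarrow> ereal) \<Rightarrow> ('h \<Rightarrow> 'g) \<Rightarrow> 'h \<Rightarrow> ereal" where
  "primal_obj f g L x = f x + g (L x)"

definition dual_obj ::
  "('h::real_inner \<Rightarrow> ereal) \<Rightarrow> ('g::real_inner \<Rightarrow> ereal) \<Rightarrow> ('h \<Rightarrow> 'g) \<Rightarrow> 'g \<Rightarrow> ereal" where
  "dual_obj f g L v = - conj_fun f (- adjoint L v) - conj_fun g v"

definition primal_val ::
  "('h \<Rightarrow> ereal) \<Rightarrow> ('g \<Rightarrow> ereal) \<Rightarrow> ('h \<Rightarrow> 'g) \<Rightarrow> ereal" where
  "primal_val f g L = (INF x. primal_obj f g L x)"

definition dual_val ::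
  "('h::real_inner \<Rightarrow> ereal) \<Rightarrow> ('g::real_inner \<Rightarrow> ereal) \<Rightarrow> ('h \<Rightarrow> 'g) \<Rightarrow> ereal" where
  "dual_val f g L = (SUP v. dual_obj f g L v)"

definition primal_sol ::
  "('h \<Rightarrow> ereal) \<Rightarrow> ('g \<Rightarrow> ereal) \<Rightarrow> ('h \<Rightarrow> 'g) \<Rightarrow> 'h \<Rightarrow> bool" where
  "primal_sol f g L x \<longleftrightarrow> primal_obj f g L x = primal_val f g L"

definition dual_sol ::
  "('h::real_inner \<Rightarrow> ereal) \<Rightarrow> ('g::real_inner \<Rightarrow> ereal) \<Rightarrow> ('h \<Rightarrow> 'g) \<Rightarrow> 'g \<Rightarrow> bool" where
  "dual_sol f g L v \<longleftrightarrow> dual_obj f g L v = dual_val f g L"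

end

theory Submission
  imports Defs "HOL-Library.Diagonal_Subsequence"
begin

text \<open>
  With \<open>w\<^sub>k = y\<^sub>k + \<gamma> z\<^sub>k\<close> the iteration is an inertial Douglas--Rachford scheme for the dual problem:
  \<open>w\<^sub>k\<^sub>+\<^sub>1 = p\<^sub>k + \<lambda>\<^sub>k (v\<^sub>k - y\<^sub>k)\<close> with \<open>p\<^sub>k = w\<^sub>k + \<alpha>\<^sub>k (w\<^sub>k - w\<^sub>k\<^sub>-\<^sub>1) = y\<^sub>k + \<gamma> q\<^sub>k\<close>, where \<open>q\<^sub>k\<close> is the sum of
  \<open>z\<^sub>k\<close> and \<open>zbar\<^sub>k\<close>. The optimality conditions of the two subproblems read \<open>y\<^sub>k \<in> \<partial>g(q\<^sub>k)\<close> and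
  \<open>- L\<^sup>* v\<^sub>k \<in> \<partial>f(x\<^sub>k\<^sub>+\<^sub>1)\<close>, and monotonicity gives
  \<open>\<langle>p\<^sub>k - w, v\<^sub>k - y\<^sub>k\<rangle> \<le> - |v\<^sub>k - y\<^sub>k|\<^sup>2\<close> for \<open>w = v + \<gamma> L x\<close> and every primal-dual solution \<open>(x, v)\<close>.
  The parameter conditions make
  \<open>|w\<^sub>k - w|\<^sup>2 - \<alpha>\<^sub>k |w\<^sub>k\<^sub>-\<^sub>1 - w|\<^sup>2 + (\<alpha> (1 + \<alpha>) + \<alpha> \<delta>) |w\<^sub>k - w\<^sub>k\<^sub>-\<^sub>1|\<^sup>2\<close> a Lyapunov function; since \<open>\<alpha>\<^sub>k\<close>
  converges to a limit below 1, \<open>|w\<^sub>k - w|\<close> converges, and Opial's argument yields weak convergence.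
  A primal-dual solution exists by the Attouch--Brezis qualification condition.
\<close>

section \<open>Closed convex functions and quadratic minimization\<close>

text \<open>Most of the analysis rests on one construction: a closed convex function plus a linear
  term plus a quadratic bounded below by the norm has a minimizer, because the parallelogram law
  makes minimizing sequences Cauchy. Riesz representation, adjoints and projections follow from it,
  and from these weak closedness of convex sets and weak sequential compactness in any dimension.
  The obstacle in the limit is that the primal and dual iterates converge only weakly, so neither
  inclusion passes to the limit alone: weak convergence does not control products such as
  \<open>V n \<bullet> L (X n)\<close>. Their difference with \<open>Y n \<bullet> Q n\<close> is
  controlled by the residual. Distances to solutions are monitored only for the combination
  \<open>w\<close>; the components are recovered because monotonicity and injectivity of
  \<open>L\<close> make \<open>w\<close> determine the primal-dual pair. For the multiplier, primal
  optimality by itself gives no bound on dual variables: as the penalty grows they might escape to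
  infinity, and the qualification condition is what prevents this.\<close>

text \<open>The pair \<open>(D, F)\<close> stands for the function that is \<open>F\<close> on \<open>D\<close> and \<open>+\<infinity>\<close> elsewhere; closedness of
  the sublevel sets is its lower semicontinuity.\<close>

definition closed_convex :: "'a::real_normed_vector set \<Rightarrow> ('a \<Rightarrow> real) \<Rightarrow> bool" where
  "closed_convex D F \<longleftrightarrow> D \<noteq> {} \<and> convex_on D F \<and> (\<forall>c. closed {x\<in>D. F x \<le> c})"

lemma convex_on_sublevel:
  assumes "convex_on D F"
  shows "convex {x\<in>D. F x \<le> (c::real)}"
proof (rule convexI)
  fix x y and s t :: real
  assume x: "x \<in> {x\<in>D. F x \<le> c}" and y: "y \<in> {x\<in>D. F x \<le> c}" and st: "0 \<le> s" "0 \<le> t" "s + t = 1"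
  then have "F (s *\<^sub>R x + t *\<^sub>R y) \<le> s * F x + t * F y" "s *\<^sub>R x + t *\<^sub>R y \<in> D"
    using assms by (auto simp: convex_on_def convex_def)
  moreover have "s * F x + t * F y \<le> c"
    using x y st by (intro convex_bound_le) auto
  ultimately show "s *\<^sub>R x + t *\<^sub>R y \<in> {x\<in>D. F x \<le> c}" by simp
qed

lemma closed_convex_combination:
  assumes "closed_convex D F" "x \<in> D" "y \<in> D" "0 \<le> t" "t \<le> 1"
  shows "x + t *\<^sub>R (y - x) \<in> D" "F (x + t *\<^sub>R (y - x)) \<le> (1 - t) * F x + t * F y"
proof -
  have c: "convex_on D F" using assms by (simp add: closed_convex_def)
  have eq: "x + t *\<^sub>R (y - x) = (1 - t) *\<^sub>R x + t *\<^sub>R y" by (simp add: algebra_simps)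
  show "x + t *\<^sub>R (y - x) \<in> D"
    unfolding eq using c assms by (simp add: convex_on_def convex_def)
  show "F (x + t *\<^sub>R (y - x)) \<le> (1 - t) * F x + t * F y"
    unfolding eq using c assms by (simp add: convex_on_def)
qed

lemma closed_convex_zero:
  assumes "C \<noteq> {}" "convex C" "closed C"
  shows "closed_convex C (\<lambda>_. 0)"
proof -
  have "closed {x \<in> C. (0::real) \<le> c}" for c
    by (cases "0 \<le> c") (use assms in auto)
  then show ?thesis
    using assms by (auto simp: closed_convex_def convex_on_def simp flip: distrib_right)
qed

text \<open>Every level above \<open>b\<close> is eventually respected, and its sublevel set is
  closed. A varying bound \<open>c\<close> absorbs null sequences; membership in \<open>D\<close> is
  concluded too, since the values of \<open>F\<close> outside \<open>D\<close> carry no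
  meaning.\<close>

lemma closed_convex_limit:
  assumes "closed_convex D F" "X \<longlonglongrightarrow> x" "c \<longlonglongrightarrow> b"
    and ev: "eventually (\<lambda>n. X n \<in> D \<and> F (X n) \<le> c n) sequentially"
  shows "x \<in> D \<and> F x \<le> b"
proof -
  have le: "x \<in> D \<and> F x \<le> e" if "b < e" for e
  proof -
    have "eventually (\<lambda>n. c n < e) sequentially" using assms(3) that by (rule order_tendstoD)
    with ev have "eventually (\<lambda>n. X n \<in> {x\<in>D. F x \<le> e}) sequentially"
      by eventually_elim auto
    moreover have "closed {x\<in>D. F x \<le> e}" using assms(1) by (simp add: closed_convex_def)
    ultimately show ?thesis
      using Lim_in_closed_set[OF _ _ _ assms(2)] by fastforce
  qed
  have "F x \<le> b" by (rule field_le_epsilon) (use le in force)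
  with le[of "b + 1"] show ?thesis by simp
qed

text \<open>A local lower bound near one point spreads by convexity: a distant point pulled toward
  \<open>x0\<close> enters the ball where \<open>F\<close> exceeds \<open>F x0 - 1\<close>, so
  \<open>F\<close> falls at most linearly. Any quadratic then dominates it.\<close>

lemma closed_convex_lower_bound:
  assumes cc: "closed_convex D F"
  shows "\<exists>c d. 0 \<le> d \<and> (\<forall>x\<in>D. c - d * norm x \<le> F x)"
proof -
  obtain x0 where x0: "x0 \<in> D" using cc by (auto simp: closed_convex_def)
  have "open (- {x\<in>D. F x \<le> F x0 - 1})" using cc by (auto simp: closed_convex_def open_Compl)
  moreover have "x0 \<in> - {x\<in>D. F x \<le> F x0 - 1}" by simp
  ultimately obtain r where r: "r > 0" and ball: "ball x0 r \<subseteq> - {x\<in>D. F x \<le> F x0 - 1}"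
    by (meson openE)
  have near: "F x0 - 1 < F x" if "x \<in> D" "dist x0 x < r" for x
    using ball that by force
  have bd: "F x0 - 1 - 2 / r * norm (x - x0) \<le> F x" if x: "x \<in> D" for x
  proof (cases "dist x0 x < r")
    case True
    have "0 \<le> 2 / r * norm (x - x0)" using r by simp
    with near[OF x True] show ?thesis by linarith
  next
    case False
    define N where "N = norm (x - x0)"
    have N: "N \<ge> r" using False by (simp add: N_def dist_norm norm_minus_commute)
    \<comment> \<open>With this choice \<open>t * N = r / 2\<close>, strictly inside the ball, and
      \<open>1 / t\<close> is the distance times the slope \<open>2 / r\<close>.\<close>
    define t where "t = r / (2 * N)"
    have t: "0 < t" "t \<le> 1" "t * N < r" using r N by (auto simp: t_def field_simps)
    have "dist x0 (x0 + t *\<^sub>R (x - x0)) < r" using t by (simp add: dist_norm N_def)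
    then have "F x0 - 1 < (1 - t) * F x0 + t * F x"
      using near closed_convex_combination[OF cc x0 x, of t] t by fastforce
    then have "t * (F x0 - F x) < 1" by (simp add: algebra_simps)
    then have "F x0 - F x < 1 / t" using t by (simp add: field_simps)
    moreover have "1 / t = 2 / r * N" by (simp add: t_def)
    ultimately show ?thesis unfolding N_def by simp
  qed
  have "(F x0 - 1 - 2 / r * norm x0) - 2 / r * norm x \<le> F x" if "x \<in> D" for x
  proof -
    have "2 / r * norm (x - x0) \<le> 2 / r * (norm x + norm x0)"
      using r by (intro mult_left_mono norm_triangle_ineq4) auto
    with bd[OF that] show ?thesis by (simp add: distrib_left)
  qed
  with r show ?thesis by (intro exI[of _ "F x0 - 1 - 2 / r * norm x0"] exI[of _ "2 / r"]) auto
qed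

lemma norm_diff_sq:
  fixes a b :: "'a::real_inner"
  shows "(norm (a - b))\<^sup>2 = (norm a)\<^sup>2 - 2 * (a \<bullet> b) + (norm b)\<^sup>2"
  by (simp add: power2_norm_eq_inner inner_diff_left inner_diff_right inner_commute)

lemma norm_add_sq:
  fixes a b :: "'a::real_inner"
  shows "(norm (a + b))\<^sup>2 = (norm a)\<^sup>2 + 2 * (a \<bullet> b) + (norm b)\<^sup>2"
  by (simp add: power2_norm_eq_inner inner_add_left inner_add_right inner_commute)

text \<open>Comparing two almost minimal points with their midpoint bounds their distance, so a
  minimizing sequence is Cauchy and closedness gives attainment. The operator \<open>K\<close> is
  kept general: it is \<open>L\<close> in the x-step, the identity in the z-step, for Riesz
  representation and for projections, and a weighted pair in the penalized problem.\<close>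

lemma minimizer_quadratic_exists:
  fixes K :: "'a::{real_inner,complete_space} \<Rightarrow> 'b::real_inner"
  assumes cc: "closed_convex D F" and l: "bounded_linear l" and K: "bounded_linear K"
    and th: "\<theta> > 0" "\<And>x. norm (K x) \<ge> \<theta> * norm x" and g: "\<gamma> > 0"
  shows "\<exists>u\<in>D. \<forall>y\<in>D. F u + l u + \<gamma> / 2 * (norm (K u - b))\<^sup>2
                          \<le> F y + l y + \<gamma> / 2 * (norm (K y - b))\<^sup>2"
proof -
  interpret l: bounded_linear l by fact
  interpret K: bounded_linear K by fact
  define E where "E x = F x + l x + \<gamma> / 2 * (norm (K x - b))\<^sup>2" for x
  obtain c d where d: "0 \<le> d" and lb: "\<And>x. x \<in> D \<Longrightarrow> c - d * norm x \<le> F x"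
    using closed_convex_lower_bound[OF cc] by blast
  obtain B where B: "\<And>x. norm (l x) \<le> norm x * B" using l.bounded by blast
  define e where "e = d + B"
  \<comment> \<open>Half of the quadratic growth is given up to absorb \<open>b\<close>. In
    \<open>m0\<close>, the term \<open>e\<^sup>2 / (4 * A)\<close> is the loss from completing the
    square in \<open>A * t\<^sup>2 - e * t\<close>.\<close>
  define A where "A = \<gamma> / 2 * (\<theta>\<^sup>2 / 2)"
  have A: "A > 0" using g th by (simp add: A_def)
  define m0 where "m0 = c - \<gamma> / 2 * (norm b)\<^sup>2 - e\<^sup>2 / (4 * A)"
  have below: "m0 \<le> E x" if x: "x \<in> D" for x
  proof -
    have "0 \<le> (norm (K x - 2 *\<^sub>R b))\<^sup>2" by simp
    then have "(norm (K x))\<^sup>2 / 2 - (norm b)\<^sup>2 \<le> (norm (K x - b))\<^sup>2"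
      unfolding norm_diff_sq by (simp add: power_mult_distrib)
    moreover have "(\<theta> * norm x)\<^sup>2 \<le> (norm (K x))\<^sup>2"
      using th by (intro power_mono) auto
    ultimately have "\<theta>\<^sup>2 / 2 * (norm x)\<^sup>2 - (norm b)\<^sup>2 \<le> (norm (K x - b))\<^sup>2"
      by (simp add: power_mult_distrib)
    then have "\<gamma> / 2 * (\<theta>\<^sup>2 / 2 * (norm x)\<^sup>2 - (norm b)\<^sup>2) \<le> \<gamma> / 2 * (norm (K x - b))\<^sup>2"
      using g by (intro mult_left_mono) auto
    then have q: "A * (norm x)\<^sup>2 - \<gamma> / 2 * (norm b)\<^sup>2 \<le> \<gamma> / 2 * (norm (K x - b))\<^sup>2"
      by (simp add: A_def algebra_simps)
    have "- (norm x * B) \<le> l x" using B[of x] by (simp add: abs_le_iff)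
    with lb[OF x] have "c - e * norm x \<le> F x + l x" by (simp add: e_def algebra_simps)
    moreover have "- (e\<^sup>2 / (4 * A)) \<le> A * (norm x)\<^sup>2 - e * norm x"
    proof -
      have "0 \<le> A * (norm x - e / (2 * A))\<^sup>2" using A by simp
      also have "\<dots> = A * (norm x)\<^sup>2 - e * norm x + e\<^sup>2 / (4 * A)"
        using A by (simp add: power2_diff power_divide field_simps power2_eq_square)
      finally show ?thesis by simp
    qed
    ultimately show ?thesis using q unfolding m0_def E_def by linarith
  qed
  define m where "m = Inf (E ` D)"
  have ne: "D \<noteq> {}" using cc by (simp add: closed_convex_def)
  have bdd: "bdd_below (E ` D)" using below by (intro bdd_belowI2)
  have mle: "m \<le> E x" if "x \<in> D" for x unfolding m_def using bdd that by (intro cInf_lower) auto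
  have "\<exists>x\<in>D. E x < m + 1 / real (Suc n)" for n
    using cInf_lessD[of "E ` D" "m + 1 / real (Suc n)"] ne by (auto simp: m_def)
  then obtain X where X: "\<And>n. X n \<in> D" "\<And>n. E (X n) < m + 1 / real (Suc n)" by metis
  \<comment> \<open>The midpoint gains \<open>\<gamma> / 2\<close> times a quarter of the squared
    distance of the images under \<open>K\<close>, and that distance is at least \<theta> times the
    original one.\<close>
  define C where "C = \<gamma> / 8 * \<theta>\<^sup>2"
  have C: "C > 0" using g th by (simp add: C_def)
  have close: "C * (dist (X i) (X j))\<^sup>2 \<le> 1 / real (Suc n)" if "n \<le> i" "n \<le> j" for i j n
  proof -
    define u where "u = X i + (1/2) *\<^sub>R (X j - X i)"
    have u: "u \<in> D" "F u \<le> (1 - 1/2) * F (X i) + 1/2 * F (X j)"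
      using closed_convex_combination[OF cc X(1) X(1), of "1/2" i j] by (auto simp: u_def)
    have Ku: "K u - b = (1/2) *\<^sub>R ((K (X i) - b) + (K (X j) - b))"
      by (simp add: u_def K.add K.scaleR K.diff algebra_simps flip: scaleR_2)
    have lu: "l u = 1/2 * l (X i) + 1/2 * l (X j)"
      by (simp add: u_def l.add l.scaleR l.diff algebra_simps)
    have par: "(norm (K u - b))\<^sup>2 = (norm (K (X i) - b))\<^sup>2 / 2 + (norm (K (X j) - b))\<^sup>2 / 2
        - (norm (K (X i) - K (X j)))\<^sup>2 / 4"
    proof -
      have "K (X i) - K (X j) = (K (X i) - b) - (K (X j) - b)" by simp
      then show ?thesis unfolding Ku norm_scaleR power_mult_distrib norm_add_sq
        by (simp only: norm_diff_sq) (simp add: power2_eq_square field_simps)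
    qed
    have "(\<theta> * norm (X i - X j))\<^sup>2 \<le> (norm (K (X i) - K (X j)))\<^sup>2"
      using th(2)[of "X i - X j"] th(1) by (intro power_mono) (auto simp: K.diff)
    then have "\<gamma> / 8 * (\<theta> * norm (X i - X j))\<^sup>2 \<le> \<gamma> / 8 * (norm (K (X i) - K (X j)))\<^sup>2"
      using g by (intro mult_left_mono) auto
    then have k: "C * (dist (X i) (X j))\<^sup>2 \<le> \<gamma> / 8 * (norm (K (X i) - K (X j)))\<^sup>2"
      by (simp add: C_def dist_norm power_mult_distrib algebra_simps)
    have "m \<le> E u" using mle u by blast
    also have "E u \<le> E (X i) / 2 + E (X j) / 2 - \<gamma> / 8 * (norm (K (X i) - K (X j)))\<^sup>2"
      using u(2) unfolding E_def par lu by (simp add: field_simps)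
    finally have *: "C * (dist (X i) (X j))\<^sup>2 \<le> E (X i) / 2 + E (X j) / 2 - m"
      using k by linarith
    have "1 / real (Suc i) \<le> 1 / real (Suc n)" "1 / real (Suc j) \<le> 1 / real (Suc n)"
      using that by (auto intro!: frac_le)
    with * X(2)[of i] X(2)[of j] show ?thesis by linarith
  qed
  have "Cauchy X"
  proof (rule metric_CauchyI)
    fix \<epsilon> :: real assume e: "\<epsilon> > 0"
    obtain n where n: "1 / real (Suc n) < C * \<epsilon>\<^sup>2"
      using reals_Archimedean[of "C * \<epsilon>\<^sup>2"] C e by (auto simp: inverse_eq_divide)
    have "dist (X i) (X j) < \<epsilon>" if "i \<ge> n" "j \<ge> n" for i j
    proof -
      have "C * (dist (X i) (X j))\<^sup>2 < C * \<epsilon>\<^sup>2" using close[OF that] n by linarith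
      then have "(dist (X i) (X j))\<^sup>2 < \<epsilon>\<^sup>2" using C by simp
      then show ?thesis using e by (meson less_imp_le power_less_imp_less_base)
    qed
    then show "\<exists>M. \<forall>m\<ge>M. \<forall>n\<ge>M. dist (X m) (X n) < \<epsilon>" by blast
  qed
  then obtain u where u: "X \<longlonglongrightarrow> u" by (meson Cauchy_convergent convergent_def)
  define Q where "Q x = l x + \<gamma> / 2 * (norm (K x - b))\<^sup>2" for x
  have "(\<lambda>n. Q (X n)) \<longlonglongrightarrow> Q u" unfolding Q_def
    by (intro tendsto_intros l.tendsto K.tendsto u)
  then have "(\<lambda>n. m + 1 / real (Suc n) - Q (X n)) \<longlonglongrightarrow> m + 0 - Q u"
    by (intro tendsto_intros LIMSEQ_Suc[OF lim_1_over_n])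
  moreover have "X n \<in> D \<and> F (X n) \<le> m + 1 / real (Suc n) - Q (X n)" for n
    using X[of n] by (simp add: E_def Q_def)
  ultimately have "u \<in> D \<and> F u \<le> m + 0 - Q u"
    using closed_convex_limit[OF cc u] by auto
  then have "u \<in> D" "E u \<le> m" by (auto simp: E_def Q_def)
  then show ?thesis using mle unfolding E_def by (meson order_trans)
qed

lemma nonneg_if_nonneg_first_order:
  fixes A B :: real
  assumes "\<And>t. 0 < t \<Longrightarrow> t < 1 \<Longrightarrow> 0 \<le> A + t * B"
  shows "0 \<le> A"
proof (rule tendsto_lowerbound)
  show "((\<lambda>t. A + t * B) \<longlongrightarrow> A) (at_right 0)" by (auto intro!: tendsto_eq_intros)
  have "eventually (\<lambda>t::real. 0 < t \<and> t < 1) (at_right 0)"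
    by (auto simp: eventually_at_right_field intro!: exI[of _ 1])
  then show "eventually (\<lambda>t. 0 \<le> A + t * B) (at_right 0)"
    by eventually_elim (use assms in auto)
qed simp

text \<open>Moving from \<open>u\<close> toward \<open>y\<close> by a fraction \<open>t\<close>,
  convexity bounds the change of \<open>F\<close> linearly and the quadratic leaves only a remainder
  of order \<open>t\<^sup>2\<close>; divide by \<open>t\<close> and let it vanish. The condition is
  stated without an adjoint of \<open>K\<close>, since Riesz representation is derived from
  it.\<close>

lemma minimizer_quadratic_subgradient:
  fixes K :: "'a::real_inner \<Rightarrow> 'b::real_inner"
  assumes cc: "closed_convex D F" and l: "bounded_linear l" and K: "bounded_linear K"
    and u: "u \<in> D" and y: "y \<in> D"
    and min: "\<And>y. y \<in> D \<Longrightarrow> F u + l u + \<gamma> / 2 * (norm (K u - b))\<^sup>2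
                          \<le> F y + l y + \<gamma> / 2 * (norm (K y - b))\<^sup>2"
  shows "F u - l (y - u) - \<gamma> * ((K u - b) \<bullet> K (y - u)) \<le> F y"
proof -
  interpret l: bounded_linear l by fact
  interpret K: bounded_linear K by fact
  define h where "h = y - u"
  have "0 \<le> (F y - F u + l h + \<gamma> * ((K u - b) \<bullet> K h)) + t * (\<gamma> / 2 * (norm (K h))\<^sup>2)"
    if t: "0 < t" "t < 1" for t
  proof -
    note cm = closed_convex_combination[OF cc u y, of t, folded h_def]
    have Q: "(norm (K (u + t *\<^sub>R h) - b))\<^sup>2
        = (norm (K u - b))\<^sup>2 + 2 * (t * ((K u - b) \<bullet> K h)) + t\<^sup>2 * (norm (K h))\<^sup>2"
    proof -
      have "K (u + t *\<^sub>R h) - b = (K u - b) + t *\<^sub>R K h" by (simp add: K.add K.scaleR)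
      then show ?thesis by (simp only: norm_add_sq) (simp add: power_mult_distrib)
    qed
    have "0 \<le> t * ((F y - F u + l h + \<gamma> * ((K u - b) \<bullet> K h)) + t * (\<gamma> / 2 * (norm (K h))\<^sup>2))"
      using min[OF cm(1)] cm(2) t unfolding Q l.add l.scaleR
      by (simp add: algebra_simps power2_eq_square)
    then show ?thesis using t by (simp add: zero_le_mult_iff)
  qed
  then have "0 \<le> F y - F u + l h + \<gamma> * ((K u - b) \<bullet> K h)" by (rule nonneg_if_nonneg_first_order)
  then show ?thesis by (simp add: h_def)
qed

section \<open>Riesz representation, adjoints and metric projections\<close>

lemma riesz_representation:
  fixes \<phi> :: "'a::{real_inner,complete_space} \<Rightarrow> real"
  assumes "bounded_linear \<phi>"
  shows "\<exists>u. \<forall>x. \<phi> x = u \<bullet> x"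
proof -
  interpret bounded_linear \<phi> by fact
  have cc: "closed_convex (UNIV::'a set) (\<lambda>_. 0)" by (rule closed_convex_zero) auto
  have l: "bounded_linear (\<lambda>x. - \<phi> x)" using assms by (rule bounded_linear_minus)
  \<comment> \<open>The representer minimizes half the squared norm minus \<phi>. Its one-sided
    first-order condition, tested at \<open>u + x\<close> and \<open>u - x\<close>, becomes an
    equality.\<close>
  obtain u where "\<forall>y\<in>UNIV. 0 + - \<phi> u + 1 / 2 * (norm (u - 0))\<^sup>2
      \<le> 0 + - \<phi> y + 1 / 2 * (norm (y - 0))\<^sup>2"
    using minimizer_quadratic_exists[OF cc l bounded_linear_ident, of 1 1 0] by auto
  then have h: "\<phi> (y - u) \<le> u \<bullet> (y - u)" for y
    using minimizer_quadratic_subgradient[OF cc l bounded_linear_ident, of u y 1 0] by simp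
  have "\<phi> x = u \<bullet> x" for x
    using h[of "u + x"] h[of "u - x"] by (simp add: neg)
  then show ?thesis by blast
qed

text \<open>\<open>adjoint\<close> is a choice, so its defining property holds once some adjoint is
  exhibited; Riesz representation provides it pointwise.\<close>

lemma adjoint_works_complete:
  fixes L :: "'a::{real_inner,complete_space} \<Rightarrow> 'b::real_inner"
  assumes "bounded_linear L"
  shows "adjoint L y \<bullet> x = y \<bullet> L x"
proof -
  have "\<exists>u. \<forall>x. y \<bullet> L x = u \<bullet> x" for y
    by (rule riesz_representation)
      (rule bounded_linear_compose[OF bounded_linear_inner_right assms])
  then obtain A where "\<And>y x. y \<bullet> L x = A y \<bullet> x" by metis
  then have "\<forall>x y. L x \<bullet> y = x \<bullet> A y" by (metis inner_commute)
  then have "\<forall>x y. L x \<bullet> y = x \<bullet> adjoint L y"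
    unfolding adjoint_def by (rule someI[where P = "\<lambda>f'. \<forall>x y. L x \<bullet> y = x \<bullet> f' y"])
  then show ?thesis by (metis inner_commute)
qed

lemma projection_exists:
  fixes C :: "'a::{real_inner,complete_space} set"
  assumes "C \<noteq> {}" "convex C" "closed C"
  shows "\<exists>p\<in>C. \<forall>y\<in>C. (x - p) \<bullet> (y - p) \<le> 0"
proof -
  have cc: "closed_convex C (\<lambda>_. 0)" using assms by (rule closed_convex_zero)
  have l: "bounded_linear (\<lambda>x::'a. 0::real)" by (rule bounded_linear_zero)
  obtain p where p: "p \<in> C" "\<And>y. y \<in> C \<Longrightarrow> 0 + 0 + 1 / 2 * (norm (p - x))\<^sup>2
      \<le> 0 + 0 + 1 / 2 * (norm (y - x))\<^sup>2"
    using minimizer_quadratic_exists[OF cc l bounded_linear_ident, of 1 1 x] by auto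
  have "(x - p) \<bullet> (y - p) \<le> 0" if "y \<in> C" for y
    using minimizer_quadratic_subgradient[OF cc l bounded_linear_ident p(1) that p(2)]
    by (simp add: inner_diff_left)
  with p show ?thesis by blast
qed

section \<open>Weak closedness and weak lower semicontinuity\<close>

lemma weakly_convergesD: "weakly_converges X l \<Longrightarrow> (\<lambda>k. X k \<bullet> u) \<longlonglongrightarrow> l \<bullet> u"
  by (simp add: weakly_converges_def)

text \<open>Test against \<open>x - p\<close>, where \<open>p\<close> is the projection of
  \<open>x\<close>: along the sequence the products are nonpositive, while their limit is the
  squared distance from \<open>x\<close> to \<open>C\<close>.\<close>

lemma weakly_closed_convex:
  fixes C :: "'a::{real_inner,complete_space} set"
  assumes w: "weakly_converges X x" and C: "convex C" "closed C"
    and ev: "eventually (\<lambda>n. X n \<in> C) sequentially"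
  shows "x \<in> C"
proof -
  have "C \<noteq> {}" using ev by (force simp: eventually_sequentially)
  then obtain p where p: "p \<in> C" "\<And>y. y \<in> C \<Longrightarrow> (x - p) \<bullet> (y - p) \<le> 0"
    using projection_exists C by metis
  have "(\<lambda>n. X n \<bullet> (x - p) - p \<bullet> (x - p)) \<longlonglongrightarrow> x \<bullet> (x - p) - p \<bullet> (x - p)"
    by (intro tendsto_intros weakly_convergesD[OF w])
  moreover have "eventually (\<lambda>n. X n \<bullet> (x - p) - p \<bullet> (x - p) \<le> 0) sequentially"
    using ev by eventually_elim (use p(2) in \<open>force simp: inner_diff_left inner_diff_right inner_commute\<close>)
  ultimately have "x \<bullet> (x - p) - p \<bullet> (x - p) \<le> 0"
    by (rule tendsto_upperbound) simp
  then have "(x - p) \<bullet> (x - p) \<le> 0" by (simp add: inner_diff_left)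
  then have "x = p" by (metis eq_iff_diff_eq_0 inner_eq_zero_iff inner_ge_zero order_antisym)
  with p show ?thesis by simp
qed

lemma closed_convex_weak_limit:
  fixes X :: "nat \<Rightarrow> 'a::{real_inner,complete_space}"
  assumes "closed_convex D F" and w: "weakly_converges X x" "c \<longlonglongrightarrow> b"
    and ev: "eventually (\<lambda>n. X n \<in> D \<and> F (X n) \<le> c n) sequentially"
  shows "x \<in> D \<and> F x \<le> b"
proof -
  have le: "x \<in> D \<and> F x \<le> e" if "b < e" for e
  proof -
    have "eventually (\<lambda>n. c n < e) sequentially" using w(2) that by (rule order_tendstoD)
    with ev have "eventually (\<lambda>n. X n \<in> {x\<in>D. F x \<le> e}) sequentially"
      by eventually_elim auto
    moreover have "closed {x\<in>D. F x \<le> e}" "convex {x\<in>D. F x \<le> e}"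
      using assms(1) by (simp_all add: closed_convex_def convex_on_sublevel)
    ultimately show ?thesis
      using weakly_closed_convex[OF w(1)] by fastforce
  qed
  have "F x \<le> b" by (rule field_le_epsilon) (use le in force)
  with le[of "b + 1"] show ?thesis by simp
qed

section \<open>Weak convergence in Hilbert spaces\<close>

lemma weakly_converges_bounded_linear:
  fixes K :: "'a::{real_inner,complete_space} \<Rightarrow> 'b::real_inner"
  assumes "bounded_linear K" "weakly_converges X a"
  shows "weakly_converges (\<lambda>n. K (X n)) (K a)"
  unfolding weakly_converges_def
  using weakly_convergesD[OF assms(2), of "adjoint K u" for u]
  by (simp add: inner_commute[of "K _"] inner_commute[of _ "adjoint K _"] 
      adjoint_works_complete[OF assms(1)])

lemma weakly_converges_add:
  assumes "weakly_converges X a" "weakly_converges Y b"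
  shows "weakly_converges (\<lambda>n. X n + Y n) (a + b)"
  using assms by (auto simp: weakly_converges_def inner_add_left intro: tendsto_add)

lemma tendsto_imp_weakly_converges:
  "X \<longlonglongrightarrow> a \<Longrightarrow> weakly_converges X a"
  by (simp add: weakly_converges_def tendsto_inner)

lemma weakly_converges_add_null:
  assumes "weakly_converges X a" "Y \<longlonglongrightarrow> 0"
  shows "weakly_converges (\<lambda>n. X n + Y n) a"
  using weakly_converges_add[OF assms(1) tendsto_imp_weakly_converges[OF assms(2)]] by simp

lemma orthogonal_decomposition:
  fixes W :: "'a::{real_inner,complete_space} set"
  assumes "subspace W" "closed W"
  shows "\<exists>p\<in>W. \<forall>y\<in>W. (x - p) \<bullet> y = 0"
proof -
  obtain p where p: "p \<in> W" "\<And>y. y \<in> W \<Longrightarrow> (x - p) \<bullet> (y - p) \<le> 0"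
    using projection_exists[of W x] assms subspace_imp_convex subspace_0 by blast
  have "(x - p) \<bullet> y = 0" if "y \<in> W" for y
    using p(2)[OF subspace_add[OF assms(1) p(1) that]] p(2)[OF subspace_diff[OF assms(1) p(1) that]]
    by simp
  with p show ?thesis by blast
qed

text \<open>A diagonal subsequence converges against every term of the sequence. The vectors against
  which it converges form a closed subspace; being orthogonal to that subspace implies being
  orthogonal to all terms, so its orthogonal complement is contained in it.\<close>

lemma bounded_imp_weakly_convergent_subseq:
  fixes X :: "nat \<Rightarrow> 'a::{real_inner,complete_space}"
  assumes "bounded (range X)"
  shows "\<exists>l r. strict_mono r \<and> weakly_converges (X \<circ> r) l"
proof -
  obtain B where B: "\<And>n. norm (X n) \<le> B" using assms by (auto simp: bounded_iff)
  have B0: "B \<ge> 0" using B[of 0] norm_ge_zero order_trans by blast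
  interpret subseqs "\<lambda>m s. convergent (\<lambda>n. X (s n) \<bullet> X m)"
  proof
    fix m and s :: "nat \<Rightarrow> nat" assume "strict_mono s"
    have "bounded (range (\<lambda>n. X (s n) \<bullet> X m))"
      unfolding bounded_iff
    proof (intro exI ballI, clarify)
      fix n
      have "norm (X (s n) \<bullet> X m) \<le> norm (X (s n)) * norm (X m)" by (simp add: Cauchy_Schwarz_ineq2)
      also have "\<dots> \<le> B * B" using B B0 by (intro mult_mono) auto
      finally show "norm (X (s n) \<bullet> X m) \<le> B * B" .
    qed
    then obtain l r where "strict_mono r" "((\<lambda>n. X (s n) \<bullet> X m) \<circ> r) \<longlonglongrightarrow> l"
      using bounded_imp_convergent_subsequence by blast
    then show "\<exists>r'. strict_mono r' \<and> convergent (\<lambda>n. X ((s \<circ> r') n) \<bullet> X m)"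
      by (auto simp: o_def convergent_def)
  qed
  define r where "r = diagseq"
  have r: "strict_mono r" by (simp add: r_def subseq_diagseq)
  have conv: "convergent (\<lambda>n. X (r n) \<bullet> X m)" for m
  proof -
    \<comment> \<open>The diagonal sequence inherits the \<open>m\<close>-th property only from
      index \<open>Suc m\<close> on, hence the shift, which does not affect convergence.\<close>
    have "convergent (\<lambda>n. X ((diagseq \<circ> (+) (Suc m)) n) \<bullet> X m)"
    proof (rule diagseq_holds)
      fix r s :: "nat \<Rightarrow> nat" and n
      assume "strict_mono r" "convergent (\<lambda>k. X (s k) \<bullet> X n)"
      then show "convergent (\<lambda>k. X ((s \<circ> r) k) \<bullet> X n)"
        using convergent_subseq_convergent[of "\<lambda>k. X (s k) \<bullet> X n" r] by (simp add: o_def)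
    qed
    then have "convergent (\<lambda>n. (\<lambda>n. X (r n) \<bullet> X m) (n + Suc m))"
      by (simp add: r_def add.commute)
    then show ?thesis by (subst (asm) convergent_ignore_initial_segment)
  qed
  define W where "W = {u. convergent (\<lambda>n. X (r n) \<bullet> u)}"
  have W: "subspace W"
    unfolding W_def subspace_def
    by (auto simp: inner_add_right convergent_const intro: convergent_add
        convergent_mult[OF convergent_const])
  have clW: "closed W"
  proof (rule closed_sequential_limits[THEN iffD2], intro allI impI, elim conjE)
    fix Y u assume Y: "\<forall>n. Y n \<in> W" "Y \<longlonglongrightarrow> u"
    have "Cauchy (\<lambda>n. X (r n) \<bullet> u)"
    proof (rule metric_CauchyI)
      fix e :: real assume e: "e > 0"
      \<comment> \<open>\<open>B + 1\<close> rather than \<open>B\<close>, because the bound may be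
        zero.\<close>
      have "e / (3 * (B + 1)) > 0" using e B0 by simp
      then obtain N where N: "dist (Y N) u < e / (3 * (B + 1))"
        using Y(2) by (meson lim_sequentially order_refl)
      have dn: "\<bar>X (r n) \<bullet> (Y N - u)\<bar> < e / 3" for n
      proof -
        have "\<bar>X (r n) \<bullet> (Y N - u)\<bar> \<le> norm (X (r n)) * norm (Y N - u)"
          by (rule Cauchy_Schwarz_ineq2)
        also have "\<dots> \<le> (B + 1) * norm (Y N - u)"
          using B[of "r n"] by (intro mult_right_mono) auto
        also have "\<dots> < e / 3" using N B0 by (simp add: dist_norm field_simps)
        finally show ?thesis .
      qed
      have "Cauchy (\<lambda>n. X (r n) \<bullet> Y N)"
        using Y(1) by (auto simp: W_def intro: convergent_Cauchy)
      then obtain M where M: "\<And>m n. m \<ge> M \<Longrightarrow> n \<ge> M \<Longrightarrow> dist (X (r m) \<bullet> Y N) (X (r n) \<bullet> Y N) < e / 3"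
        using e metric_CauchyD[of _ "e / 3"] by (metis zero_less_divide_iff zero_less_numeral)
      have "dist (X (r m) \<bullet> u) (X (r n) \<bullet> u) < e" if "m \<ge> M" "n \<ge> M" for m n
        using M[OF that] dn[of m] dn[of n] unfolding dist_real_def inner_diff_right by linarith
      then show "\<exists>M. \<forall>m\<ge>M. \<forall>n\<ge>M. dist (X (r m) \<bullet> u) (X (r n) \<bullet> u) < e" by blast
    qed
    then show "u \<in> W" by (simp add: W_def real_Cauchy_convergent)
  qed
  have "u \<in> W" for u
  proof -
    obtain p where p: "p \<in> W" "\<And>y. y \<in> W \<Longrightarrow> (u - p) \<bullet> y = 0"
      using orthogonal_decomposition[OF W clW] by metis
    have "X (r n) \<bullet> (u - p) = 0" for n
      using p(2)[of "X (r n)"] conv by (simp add: W_def inner_commute)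
    then have "u - p \<in> W" by (simp add: W_def convergent_const)
    with subspace_add[OF W p(1) this] show ?thesis by simp
  qed
  then have "\<forall>u. \<exists>l. (\<lambda>n. X (r n) \<bullet> u) \<longlonglongrightarrow> l" by (simp add: W_def convergent_def)
  then obtain \<phi> where \<phi>: "\<And>u. (\<lambda>n. X (r n) \<bullet> u) \<longlonglongrightarrow> \<phi> u" by metis
  have "bounded_linear \<phi>"
  proof (rule bounded_linear_intro)
    show "\<phi> (u + v) = \<phi> u + \<phi> v" for u v
      using tendsto_add[OF \<phi>[of u] \<phi>[of v]] \<phi>[of "u + v"]
      by (auto simp: inner_add_right dest: LIMSEQ_unique)
    show "\<phi> (c *\<^sub>R u) = c *\<^sub>R \<phi> u" for c u
      using tendsto_mult[OF tendsto_const \<phi>[of u], of c] \<phi>[of "c *\<^sub>R u"]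
      by (auto dest: LIMSEQ_unique)
    show "norm (\<phi> u) \<le> norm u * B" for u
    proof (rule tendsto_upperbound)
      show "(\<lambda>n. norm (X (r n) \<bullet> u)) \<longlonglongrightarrow> norm (\<phi> u)" by (intro tendsto_norm \<phi>)
      have "norm (X (r n) \<bullet> u) \<le> norm u * B" for n
        using Cauchy_Schwarz_ineq2[of "X (r n)" u] mult_right_mono[OF B[of "r n"] norm_ge_zero[of u]]
        by (simp add: mult.commute)
      then show "eventually (\<lambda>n. norm (X (r n) \<bullet> u) \<le> norm u * B) sequentially" by simp
    qed simp
  qed
  then obtain l where "\<And>u. \<phi> u = l \<bullet> u" using riesz_representation by blast
  with \<phi> r show ?thesis by (auto simp: weakly_converges_def o_def)
qed

lemma weakly_converges_if_unique_cluster_point: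
  fixes X :: "nat \<Rightarrow> 'a::{real_inner,complete_space}"
  assumes bd: "bounded (range X)"
    and uniq: "\<And>r l. strict_mono r \<Longrightarrow> weakly_converges (X \<circ> r) l \<Longrightarrow> l = a"
  shows "weakly_converges X a"
  unfolding weakly_converges_def
proof (intro allI, rule ccontr)
  fix u assume "\<not> (\<lambda>k. X k \<bullet> u) \<longlonglongrightarrow> a \<bullet> u"
  then obtain e where e: "e > 0" "\<And>N. \<exists>n\<ge>N. \<not> dist (X n \<bullet> u) (a \<bullet> u) < e"
    by (auto simp: lim_sequentially)
  define S where "S = {n. \<not> dist (X n \<bullet> u) (a \<bullet> u) < e}"
  have "infinite S" unfolding S_def infinite_nat_iff_unbounded_le using e(2) by auto
  then obtain s :: "nat \<Rightarrow> nat" where s: "strict_mono s" "\<And>n. s n \<in> S"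
    using infinite_enumerate by blast
  have "bounded (range (X \<circ> s))" using bd by (rule bounded_subset) auto
  then obtain l r where r: "strict_mono r" "weakly_converges ((X \<circ> s) \<circ> r) l"
    using bounded_imp_weakly_convergent_subseq by blast
  then have "l = a" using uniq[of "s \<circ> r" l] s(1) by (simp add: o_assoc strict_mono_o)
  then have "(\<lambda>n. X (s (r n)) \<bullet> u) \<longlonglongrightarrow> a \<bullet> u" using weakly_convergesD[OF r(2), of u] by simp
  then obtain n where "dist (X (s (r n)) \<bullet> u) (a \<bullet> u) < e" using e(1) by (auto simp: lim_sequentially)
  with s(2)[of "r n"] show False by (simp add: S_def)
qed

text \<open>Banach-Steinhaus on \<open>V\<close>: the closed sets \<open>A m\<close> cover a
  complete space, so by Baire one of them contains a relative ball. Upper bounds alone suffice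
  because \<open>V\<close> contains \<open>- s\<close> along with \<open>s\<close>.\<close>

lemma pointwise_bounded_imp_bounded:
  fixes v :: "nat \<Rightarrow> 'a::{real_inner,complete_space}"
  assumes V: "subspace V" "closed V" and vV: "\<And>n. v n \<in> V"
    and pw: "\<And>s. s \<in> V \<Longrightarrow> \<exists>C. \<forall>n. v n \<bullet> s \<le> C"
  shows "bounded (range v)"
proof -
  let ?T = "top_of_set V"
  define A where "A m = (\<Inter>n. {s\<in>V. v n \<bullet> s \<le> real m})" for m :: nat
  have clA: "closedin ?T (A m)" for m
  proof -
    have "A m = V \<inter> (\<Inter>n. {s. v n \<bullet> s \<le> real m})" by (auto simp: A_def)
    then show ?thesis
      by (metis closed_INT closed_halfspace_le closedin_closed_Int)
  qed
  have un: "\<Union>(range A) = V"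
  proof
    show "V \<subseteq> \<Union>(range A)"
    proof
      fix s assume s: "s \<in> V"
      then obtain C where C: "\<And>n. v n \<bullet> s \<le> C" using pw by blast
      obtain m :: nat where "C \<le> real m" using real_arch_simple by blast
      with C s show "s \<in> \<Union>(range A)" by (auto simp: A_def intro: order_trans)
    qed
  qed (auto simp: A_def)
  have "\<not> (\<forall>m. ?T interior_of (A m) = {})"
  proof
    assume "\<forall>m. ?T interior_of (A m) = {}"
    moreover have "completely_metrizable_space ?T"
      using completely_metrizable_space_closedin[OF completely_metrizable_space_euclidean] V(2) by simp
    ultimately have "?T interior_of (\<Union>(range A)) = {}"
      using clA by (intro Baire_category_alt) auto
    then have "V = {}" unfolding un by (metis interior_of_topspace topspace_euclidean_subtopology)
    then show False using subspace_0[OF V(1)] by auto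
  qed
  then obtain m where "?T interior_of (A m) \<noteq> {}" by blast
  then obtain U s where U: "openin ?T U" "U \<subseteq> A m" "s \<in> U"
    by (auto simp: interior_of_def)
  then obtain e where e: "e > 0" "\<And>x. x \<in> V \<Longrightarrow> dist x s < e \<Longrightarrow> x \<in> U" and sV: "s \<in> V"
    unfolding openin_euclidean_subtopology_iff by blast
  obtain C where C: "\<And>n. v n \<bullet> (- s) \<le> C" using pw[OF subspace_neg[OF V(1) sV]] by blast
  have "norm (v n) \<le> 2 * (real m + C) / e" for n
  proof (cases "v n = 0")
    case False
    \<comment> \<open>\<open>h\<close> has length \<open>e / 2\<close> and the direction of
      \<open>v n\<close>, so the product with \<open>v n\<close> reads off its norm. The bound at
      \<open>- s\<close> shifts the ball from \<open>s\<close> to the origin.\<close>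
    define h where "h = (e / (2 * norm (v n))) *\<^sub>R v n"
    have h: "norm h < e" using e False by (simp add: h_def)
    have "s + h \<in> V" using sV vV V by (simp add: h_def subspace_add subspace_scale)
    with e(2)[of "s + h"] h U(2) have "s + h \<in> A m" by (auto simp: dist_norm)
    then have "v n \<bullet> (s + h) \<le> real m" by (simp add: A_def)
    moreover have "v n \<bullet> h = e / 2 * norm (v n)"
      using False by (simp add: h_def dot_square_norm power2_eq_square)
    ultimately have "e / 2 * norm (v n) \<le> real m + C"
      using C[of n] by (simp add: inner_add_right)
    then show ?thesis using e by (simp add: field_simps)
  next
    case True
    then have "s \<in> A m" "v n \<bullet> s = 0" using U by auto
    then show ?thesis using True C[of n] e by simp
  qed
  then show ?thesis by (auto simp: bounded_iff)
qed

section \<open>Existence of dual multipliers\<close>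

lemma closed_convex_eventually_greater:
  assumes "closed_convex D F" "X \<longlonglongrightarrow> x" "\<And>n. X n \<in> D" "e > 0" "x \<in> D"
  shows "eventually (\<lambda>n. F x - e < F (X n)) sequentially"
proof -
  have "open (- {x'\<in>D. F x' \<le> F x - e})" using assms(1) by (auto simp: closed_convex_def)
  moreover have "x \<in> - {x'\<in>D. F x' \<le> F x - e}" using assms(4) by simp
  ultimately have "eventually (\<lambda>n. X n \<in> - {x'\<in>D. F x' \<le> F x - e}) sequentially"
    using assms(2) topological_tendstoD by blast
  then show ?thesis by eventually_elim (use assms(3) in force)
qed

lemma closed_convex_bounded_below_convergent:
  assumes "closed_convex D F" "X \<longlonglongrightarrow> x" "\<And>n. X n \<in> D"
  shows "\<exists>m. \<forall>n. m \<le> F (X n)"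
proof -
  obtain c d where d: "0 \<le> d" "\<And>x. x \<in> D \<Longrightarrow> c - d * norm x \<le> F x"
    using closed_convex_lower_bound[OF assms(1)] by blast
  obtain B where B: "\<And>n. norm (X n) \<le> B"
    using assms(2) by (metis BseqE convergentI convergent_imp_Bseq)
  have "c - d * B \<le> F (X n)" for n
    using d(2)[OF assms(3), of n] mult_left_mono[OF B d(1), of n] by linarith
  then show ?thesis by blast
qed

text \<open>For closedness, a bound on the sum must first be split: along a convergent sequence each
  summand is bounded below, hence the other one above, which puts the limits into the domains. Only
  then can the two lower semicontinuity estimates be added.\<close>

lemma closed_convex_separable_sum:
  assumes F: "closed_convex D F" and G: "closed_convex E G"
  shows "closed_convex (D \<times> E) (\<lambda>p. F (fst p) + G (snd p))"
  unfolding closed_convex_def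
proof (intro conjI allI)
  show "D \<times> E \<noteq> {}" using F G by (auto simp: closed_convex_def)
  have FG: "convex_on D F" "convex_on E G" using F G by (auto simp: closed_convex_def)
  show "convex_on (D \<times> E) (\<lambda>p. F (fst p) + G (snd p))"
    unfolding convex_on_def
  proof (intro conjI ballI allI impI)
    show "convex (D \<times> E)" using FG by (simp add: convex_on_def convex_Times)
    fix p q and s t :: real
    assume "p \<in> D \<times> E" "q \<in> D \<times> E" "0 \<le> s" "0 \<le> t" "s + t = 1"
    then have "F (s *\<^sub>R fst p + t *\<^sub>R fst q) \<le> s * F (fst p) + t * F (fst q)"
      "G (s *\<^sub>R snd p + t *\<^sub>R snd q) \<le> s * G (snd p) + t * G (snd q)"
      using FG by (auto simp: convex_on_def)
    then show "F (fst (s *\<^sub>R p + t *\<^sub>R q)) + G (snd (s *\<^sub>R p + t *\<^sub>R q))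
        \<le> s * (F (fst p) + G (snd p)) + t * (F (fst q) + G (snd q))"
      by (simp add: distrib_left)
  qed
next
  fix c
  show "closed {p \<in> D \<times> E. F (fst p) + G (snd p) \<le> c}"
  proof (rule closed_sequential_limits[THEN iffD2], intro allI impI, elim conjE)
    fix P p assume P: "\<forall>n. P n \<in> {p \<in> D \<times> E. F (fst p) + G (snd p) \<le> c}" "P \<longlonglongrightarrow> p"
    define X Y where "X n = fst (P n)" and "Y n = snd (P n)" for n
    have XY: "X \<longlonglongrightarrow> fst p" "Y \<longlonglongrightarrow> snd p"
      unfolding X_def Y_def using P(2) by (simp_all add: tendsto_fst tendsto_snd)
    have mem: "\<And>n. X n \<in> D" "\<And>n. Y n \<in> E" "\<And>n. F (X n) + G (Y n) \<le> c"
      using P(1) by (auto simp: X_def Y_def mem_Times_iff)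
    obtain a b where ab: "\<And>n. a \<le> F (X n)" "\<And>n. b \<le> G (Y n)"
      using closed_convex_bounded_below_convergent[OF F XY(1) mem(1)]
        closed_convex_bounded_below_convergent[OF G XY(2) mem(2)] by blast
    have "F (X n) \<le> c - b" "G (Y n) \<le> c - a" for n using ab[of n] mem(3)[of n] by auto
    then have in_dom: "fst p \<in> D" "snd p \<in> E"
      using closed_convex_limit[OF F XY(1) tendsto_const] closed_convex_limit[OF G XY(2) tendsto_const]
        mem by (auto intro!: always_eventually)
    have "F (fst p) + G (snd p) \<le> c"
    proof (rule field_le_epsilon)
      fix e :: real assume e: "e > 0"
      then have "e / 2 > 0" by simp
      from closed_convex_eventually_greater[OF F XY(1) mem(1) this in_dom(1)]
        closed_convex_eventually_greater[OF G XY(2) mem(2) this in_dom(2)]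
      have "eventually (\<lambda>n. F (fst p) + G (snd p) - e < c) sequentially"
      proof eventually_elim
        case (elim n)
        then show ?case using mem(3)[of n] by linarith
      qed
      then show "F (fst p) + G (snd p) \<le> c + e" by simp
    qed
    with in_dom show "p \<in> {p \<in> D \<times> E. F (fst p) + G (snd p) \<le> c}" by (simp add: mem_Times_iff)
  qed
qed

definition subgradient :: "'a::real_inner set \<Rightarrow> ('a \<Rightarrow> real) \<Rightarrow> 'a \<Rightarrow> 'a \<Rightarrow> bool" where
  "subgradient D F x v \<longleftrightarrow> x \<in> D \<and> (\<forall>y\<in>D. F x + v \<bullet> (y - x) \<le> F y)"

lemma subgradient_monotone:
  assumes "subgradient D F x u" "subgradient D F y v"
  shows "0 \<le> (u - v) \<bullet> (x - y)"
proof -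
  have "F x + u \<bullet> (y - x) \<le> F y" "F y + v \<bullet> (x - y) \<le> F x"
    using assms by (auto simp: subgradient_def)
  then show ?thesis by (simp add: inner_diff_left inner_diff_right)
qed

text \<open>The constraint \<open>q = L x\<close> is relaxed by a penalty, and the term centered at
  \<open>x0\<close> makes the joint quadratic coercive in both variables. Writing both as one norm
  \<open>norm (K p - b)\<close> reduces the claim to quadratic minimization; the second conjunct is
  the first-order condition.\<close>

lemma penalized_problem_solution:
  fixes L :: "'h::{real_inner,complete_space} \<Rightarrow> 'g::{real_inner,complete_space}"
  assumes F: "closed_convex D F" and G: "closed_convex E G" and L: "bounded_linear L"
    and n: "n \<ge> (1::real)"
  shows "\<exists>x\<in>D. \<exists>q\<in>E.
     (\<forall>x'\<in>D. \<forall>q'\<in>E. F x + G q + 1/2 * (norm (x - x0))\<^sup>2 + n/2 * (norm (q - L x))\<^sup>2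
        \<le> F x' + G q' + 1/2 * (norm (x' - x0))\<^sup>2 + n/2 * (norm (q' - L x'))\<^sup>2)
   \<and> (\<forall>x'\<in>D. \<forall>q'\<in>E. F x + G q - (x - x0) \<bullet> (x' - x)
        - n * ((q - L x) \<bullet> ((q' - q) - L (x' - x))) \<le> F x' + G q')"
proof -
  interpret L: bounded_linear L by fact
  define \<Phi> where "\<Phi> p = F (fst p) + G (snd p)" for p :: "'h \<times> 'g"
  define K where "K p = (fst p, sqrt n *\<^sub>R (snd p - L (fst p)))" for p :: "'h \<times> 'g"
  define b where "b = (x0, 0::'g)"
  have cc: "closed_convex (D \<times> E) \<Phi>"
    using closed_convex_separable_sum[OF F G] by (simp add: \<Phi>_def[abs_def])
  have l: "bounded_linear (\<lambda>_::'h\<times>'g. 0::real)" by (rule bounded_linear_zero)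
  have K: "bounded_linear K" unfolding K_def[abs_def]
    by (intro bounded_linear_Pair bounded_linear_fst
        bounded_linear_compose[OF bounded_linear_scaleR_right] bounded_linear_sub bounded_linear_snd
        bounded_linear_compose[OF L bounded_linear_fst])
  obtain M where M: "M > 0" "\<And>x. norm (L x) \<le> norm x * M" using L.pos_bounded by blast
  \<comment> \<open>\<open>q\<close> is controlled through \<open>q - L x\<close> and
    \<open>x\<close>, with \<open>M\<close> bounding \<open>L\<close>; \<open>n \<ge> 1\<close>
    keeps the factor \<open>sqrt n\<close> from weakening the estimate.\<close>
  have below: "1 / (2 + M) * norm p \<le> norm (K p)" for p
  proof -
    have 1: "norm (fst p) \<le> norm (K p)" by (metis K_def fst_conv norm_fst_le)
    have "norm (snd p - L (fst p)) \<le> sqrt n * norm (snd p - L (fst p))"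
      using n by (simp add: mult_le_cancel_right1)
    also have "\<dots> = norm (snd (K p))" using n by (simp add: K_def)
    also have "\<dots> \<le> norm (K p)" by (metis norm_snd_le surjective_pairing)
    finally have 2: "norm (snd p - L (fst p)) \<le> norm (K p)" .
    have "norm p \<le> norm (fst p) + norm (snd p)"
      by (metis norm_Pair_le surjective_pairing)
    also have "norm (snd p) \<le> norm (snd p - L (fst p)) + norm (L (fst p))"
      by (metis diff_add_cancel norm_triangle_ineq)
    also have "norm (L (fst p)) \<le> norm (K p) * M"
      using M(2)[of "fst p"] mult_right_mono[OF 1, of M] M(1) by linarith
    finally have "norm p \<le> (2 + M) * norm (K p)" using 1 2 by (simp add: algebra_simps)
    then show ?thesis using M(1) by (simp add: field_simps)
  qed
  have pos: "1 / (2 + M) > 0" using M(1) by simp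
  obtain p where p: "p \<in> D \<times> E"
    and min: "\<And>p'. p' \<in> D \<times> E \<Longrightarrow> \<Phi> p + 0 + 1 / 2 * (norm (K p - b))\<^sup>2
                          \<le> \<Phi> p' + 0 + 1 / 2 * (norm (K p' - b))\<^sup>2"
    using minimizer_quadratic_exists[OF cc l K pos below zero_less_one, of b] by auto
  have sub: "\<Phi> p - 0 - 1 * ((K p - b) \<bullet> K (p' - p)) \<le> \<Phi> p'" if "p' \<in> D \<times> E" for p'
    by (rule minimizer_quadratic_subgradient[OF cc l K p that min])
  have nK: "1 / 2 * (norm (K p' - b))\<^sup>2
      = 1/2 * (norm (fst p' - x0))\<^sup>2 + n/2 * (norm (snd p' - L (fst p')))\<^sup>2" for p'
    using n by (simp add: K_def b_def norm_prod_def power_mult_distrib)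
  have iK: "(K p - b) \<bullet> K (p' - p) = (fst p - x0) \<bullet> (fst p' - fst p)
      + n * ((snd p - L (fst p)) \<bullet> ((snd p' - snd p) - L (fst p' - fst p)))" for p'
    using n by (simp add: K_def b_def inner_prod_def L.diff flip: scaleR_diff_right)
  show ?thesis
  proof (rule bexI[of _ "fst p"], rule bexI[of _ "snd p"], intro conjI ballI)
    fix x' q' assume "x' \<in> D" "q' \<in> E"
    then have m: "(x', q') \<in> D \<times> E" by simp
    show "F (fst p) + G (snd p) + 1/2 * (norm (fst p - x0))\<^sup>2 + n/2 * (norm (snd p - L (fst p)))\<^sup>2
        \<le> F x' + G q' + 1/2 * (norm (x' - x0))\<^sup>2 + n/2 * (norm (q' - L x'))\<^sup>2"
      using min[OF m] unfolding nK by (simp add: \<Phi>_def)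
    show "F (fst p) + G (snd p) - (fst p - x0) \<bullet> (x' - fst p)
        - n * ((snd p - L (fst p)) \<bullet> ((q' - snd p) - L (x' - fst p))) \<le> F x' + G q'"
      using sub[OF m] unfolding iK by (simp add: \<Phi>_def)
  qed (use p in auto)
qed

text \<open>Attouch--Brezis duality. The penalized multipliers \<open>n (L x\<^sub>n - q\<^sub>n)\<close> lie in the closed subspace
  generated by the qualification condition and are pointwise bounded above on it, hence bounded.\<close>

lemma dual_multiplier_exists:
  fixes L :: "'h::{real_inner,complete_space} \<Rightarrow> 'g::{real_inner,complete_space}"
  assumes F: "closed_convex D F" and G: "closed_convex E G" and L: "bounded_linear L"
    and xb: "xb \<in> D" "L xb \<in> E"
    and opt: "\<And>x. x \<in> D \<Longrightarrow> L x \<in> E \<Longrightarrow> F xb + G (L xb) \<le> F x + G (L x)"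
    and V: "subspace V" "closed V"
    and SV: "\<And>a b. a \<in> E \<Longrightarrow> b \<in> D \<Longrightarrow> a - L b \<in> V"
    and VS: "\<And>w. w \<in> V \<Longrightarrow> \<exists>l>0. \<exists>a\<in>E. \<exists>b\<in>D. w = l *\<^sub>R (a - L b)"
  shows "\<exists>v. subgradient E G (L xb) v \<and> (\<forall>x\<in>D. F xb - v \<bullet> L (x - xb) \<le> F x)"
proof -
  interpret L: bounded_linear L by fact
  obtain M where M: "M > 0" "\<And>x. norm (L x) \<le> norm x * M" using L.pos_bounded by blast
  define P where "P = F xb + G (L xb)"
  have "\<exists>x q. x \<in> D \<and> q \<in> E \<and>
     (\<forall>x'\<in>D. \<forall>q'\<in>E. F x + G q + 1/2 * (norm (x - xb))\<^sup>2 + real (Suc n)/2 * (norm (q - L x))\<^sup>2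
        \<le> F x' + G q' + 1/2 * (norm (x' - xb))\<^sup>2 + real (Suc n)/2 * (norm (q' - L x'))\<^sup>2)
   \<and> (\<forall>x'\<in>D. \<forall>q'\<in>E. F x + G q - (x - xb) \<bullet> (x' - x)
        - real (Suc n) * ((q - L x) \<bullet> ((q' - q) - L (x' - x))) \<le> F x' + G q')" for n
    using penalized_problem_solution[OF F G L, of "real (Suc n)" xb] by auto
  then obtain X Q where XQ: "\<And>n. X n \<in> D" "\<And>n. Q n \<in> E"
    and min: "\<And>n x' q'. x' \<in> D \<Longrightarrow> q' \<in> E \<Longrightarrow>
        F (X n) + G (Q n) + 1/2 * (norm (X n - xb))\<^sup>2 + real (Suc n)/2 * (norm (Q n - L (X n)))\<^sup>2
        \<le> F x' + G q' + 1/2 * (norm (x' - xb))\<^sup>2 + real (Suc n)/2 * (norm (q' - L x'))\<^sup>2"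
    and sub: "\<And>n x' q'. x' \<in> D \<Longrightarrow> q' \<in> E \<Longrightarrow>
        F (X n) + G (Q n) - (X n - xb) \<bullet> (x' - X n)
        - real (Suc n) * ((Q n - L (X n)) \<bullet> ((q' - Q n) - L (x' - X n))) \<le> F x' + G q'"
    by metis
  define s where "s n = norm (X n - xb)" for n
  define p where "p n = Q n - L (X n)" for n
  \<comment> \<open>Minus the gradient of the penalty in \<open>q\<close>. The first-order condition
    with \<open>x' = X n\<close> says that \<open>v n\<close> is a subgradient of \<open>G\<close>
    at \<open>Q n\<close>.\<close>
  define v where "v n = - real (Suc n) *\<^sub>R p n" for n
  have min0: "F (X n) + G (Q n) + 1/2 * (s n)\<^sup>2 + real (Suc n)/2 * (norm (p n))\<^sup>2 \<le> P" for n
    using min[OF xb, of n] by (simp add: P_def s_def p_def)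
  obtain c1 d1 where lb1: "0 \<le> d1" "\<And>x. x \<in> D \<Longrightarrow> c1 - d1 * norm x \<le> F x"
    using closed_convex_lower_bound[OF F] by blast
  obtain c2 d2 where lb2: "0 \<le> d2" "\<And>x. x \<in> E \<Longrightarrow> c2 - d2 * norm x \<le> G x"
    using closed_convex_lower_bound[OF G] by blast
  define e where "e = d1 + d2 * M + d2"
  define C1 where "C1 = (d1 + d2 * M) * norm xb - c1 - c2"
  have e: "e \<ge> 0" using lb1 lb2 M by (simp add: e_def)
  have s0: "s n \<ge> 0" for n by (simp add: s_def)
  have FG: "- C1 - e * s n - e * norm (p n) \<le> F (X n) + G (Q n)" for n
  proof -
    have nx: "norm (X n) \<le> s n + norm xb"
      using norm_triangle_ineq[of "X n - xb" xb] by (simp add: s_def)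
    have "norm (Q n) \<le> norm (p n) + norm (L (X n))"
      using norm_triangle_ineq[of "p n" "L (X n)"] by (simp add: p_def)
    also have "norm (L (X n)) \<le> M * (s n + norm xb)"
      using order_trans[OF M(2) mult_right_mono[OF nx]] M(1) by (simp add: mult.commute[of M])
    finally have nq: "norm (Q n) \<le> norm (p n) + M * (s n + norm xb)" by simp
    have "0 \<le> d2 * s n" "0 \<le> (d1 + d2 * M) * norm (p n)"
      using lb1 lb2 M s0 by auto
    then show ?thesis
      using lb1(2)[OF XQ(1), of n] lb2(2)[OF XQ(2), of n]
        mult_left_mono[OF nx lb1(1)] mult_left_mono[OF nq lb2(1)]
      by (simp add: C1_def e_def algebra_simps)
  qed
  \<comment> \<open>Linear lower bounds against the two quadratics: completing squares centers both
    \<open>s n\<close> and \<open>norm (p n)\<close> at \<open>e\<close>.\<close>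
  define R where "R = e + sqrt (2 * (P + C1) + 2 * e\<^sup>2)"
  have bnd: "s n \<le> R" "norm (p n) \<le> R" for n
  proof -
    have "1/2 * (norm (p n))\<^sup>2 \<le> real (Suc n)/2 * (norm (p n))\<^sup>2"
      by (intro mult_right_mono) auto
    then have "(s n)\<^sup>2 + (norm (p n))\<^sup>2 \<le> 2 * P + 2 * C1 + 2 * (e * s n) + 2 * (e * norm (p n))"
      using min0[of n] FG[of n] by linarith
    then have "(s n - e)\<^sup>2 + (norm (p n) - e)\<^sup>2 \<le> 2 * (P + C1) + 2 * e\<^sup>2"
      by (simp add: power2_diff algebra_simps)
    then have "(s n - e)\<^sup>2 \<le> 2 * (P + C1) + 2 * e\<^sup>2" "(norm (p n) - e)\<^sup>2 \<le> 2 * (P + C1) + 2 * e\<^sup>2"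
      by (smt (verit) zero_le_power2)+
    then have "s n - e \<le> sqrt (2 * (P + C1) + 2 * e\<^sup>2)" "norm (p n) - e \<le> sqrt (2 * (P + C1) + 2 * e\<^sup>2)"
      by (auto intro: real_le_rsqrt)
    then show "s n \<le> R" "norm (p n) \<le> R" by (auto simp: R_def)
  qed
  have R0: "R \<ge> 0" using bnd(1)[of 0] s0[of 0] by linarith
  have FGR: "- C1 - 2 * e * R \<le> F (X n) + G (Q n)" for n
    using FG[of n] mult_left_mono[OF bnd(1) e, of n] mult_left_mono[OF bnd(2) e, of n] by linarith
  have p0: "p \<longlonglongrightarrow> 0"
  proof -
    define B where "B = 2 * (P + C1 + 2 * e * R)"
    have "(norm (p n))\<^sup>2 \<le> B * (1 / real (Suc n))" for n
    proof -
      have "real (Suc n) / 2 * (norm (p n))\<^sup>2 \<le> P + C1 + 2 * e * R"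
        using min0[of n] FGR[of n] zero_le_power2[of "s n"] by linarith
      then show ?thesis by (simp add: B_def field_simps)
    qed
    moreover have "(\<lambda>n. B * (1 / real (Suc n))) \<longlonglongrightarrow> B * 0"
      by (intro tendsto_intros LIMSEQ_Suc[OF lim_1_over_n])
    ultimately have "(\<lambda>n. (norm (p n))\<^sup>2) \<longlonglongrightarrow> 0"
      using tendsto_sandwich[of "\<lambda>_. 0" "\<lambda>n. (norm (p n))\<^sup>2" sequentially "\<lambda>n. B * (1 / real (Suc n))" 0]
      by auto
    then have "(\<lambda>n. sqrt ((norm (p n))\<^sup>2)) \<longlonglongrightarrow> sqrt 0" by (rule tendsto_real_sqrt)
    then show ?thesis by (simp add: tendsto_norm_zero_iff)
  qed
  \<comment> \<open>The square of the constraint violation has a favorable sign and is dropped. What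
    remains bounds \<open>v n\<close> from above in every direction \<open>a - L b\<close>, and
    these directions generate \<open>V\<close>.\<close>
  have key: "F (X n) + G (Q n) \<le> F b + G a + (X n - xb) \<bullet> (b - X n) - v n \<bullet> (a - L b)"
    if "a \<in> E" "b \<in> D" for a b n
  proof -
    have eq: "(a - Q n) - L (b - X n) = (a - L b) - p n" by (simp add: p_def L.diff)
    have "- (real (Suc n) * (p n \<bullet> ((a - Q n) - L (b - X n))))
        = v n \<bullet> (a - L b) + real (Suc n) * (p n \<bullet> p n)"
      unfolding eq v_def by (simp only: inner_diff_right inner_scaleR_left) (simp add: algebra_simps)
    moreover have "0 \<le> real (Suc n) * (p n \<bullet> p n)" by simp
    ultimately show ?thesis using sub[OF that(2,1), of n] unfolding p_def[symmetric] by linarith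
  qed
  have vV: "v n \<in> V" for n
    using SV[OF XQ(2,1)] V(1) by (auto simp: v_def p_def intro!: subspace_neg subspace_scale)
  have bv: "bounded (range v)"
  proof (rule pointwise_bounded_imp_bounded[OF V vV])
    fix w assume "w \<in> V"
    then obtain l a b where l: "l > 0" and a: "a \<in> E" and b: "b \<in> D" and w: "w = l *\<^sub>R (a - L b)"
      using VS by blast
    define C where "C = F b + G a + R * (norm (b - xb) + R) + C1 + 2 * e * R"
    have "v n \<bullet> (a - L b) \<le> C" for n
    proof -
      have "(X n - xb) \<bullet> (b - X n) \<le> norm (X n - xb) * norm (b - X n)"
        by (rule norm_cauchy_schwarz)
      also have "\<dots> \<le> R * (norm (b - xb) + R)"
        using bnd(1)[of n] norm_triangle_ineq4[of "b - xb" "X n - xb"] R0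
        by (intro mult_mono) (auto simp: s_def)
      finally show ?thesis using key[OF a b, of n] FGR[of n] by (simp add: C_def)
    qed
    then have "v n \<bullet> w \<le> l * C" for n using l by (simp add: w)
    then show "\<exists>C. \<forall>n. v n \<bullet> w \<le> C" by blast
  qed
  then obtain Bv where Bv: "\<And>n. norm (v n) \<le> Bv" by (auto simp: bounded_iff)
  \<comment> \<open>Weak compactness is applied in the product space so that one subsequence serves
    the points, their squared distances and the multipliers.\<close>
  have "bounded (range (\<lambda>n. (X n, (s n)\<^sup>2, v n)))"
    unfolding bounded_iff
  proof (intro exI ballI, clarify)
    fix n
    have "norm (X n) \<le> R + norm xb"
      using norm_triangle_ineq[of "X n - xb" xb] bnd(1)[of n] by (simp add: s_def)
    moreover have "(s n)\<^sup>2 \<le> R\<^sup>2" using bnd(1) s0 by (intro power_mono)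
    moreover have "norm (X n, (s n)\<^sup>2, v n) \<le> norm (X n) + (norm ((s n)\<^sup>2) + norm (v n))"
      using norm_Pair_le[of "X n" "((s n)\<^sup>2, v n)"] norm_Pair_le[of "(s n)\<^sup>2" "v n"] by linarith
    ultimately show "norm (X n, (s n)\<^sup>2, v n) \<le> R + norm xb + (R\<^sup>2 + Bv)"
      using Bv[of n] by simp
  qed
  from bounded_imp_weakly_convergent_subseq[OF this]
  obtain l r where r: "strict_mono r"
    and wl: "weakly_converges ((\<lambda>n. (X n, (s n)\<^sup>2, v n)) \<circ> r) l" by blast
  obtain xt \<sigma> vt where l: "l = (xt, \<sigma>, vt)" by (rule prod_cases3)
  note wc = wl[unfolded l]
  have wX: "weakly_converges (X \<circ> r) xt"
    using weakly_convergesD[OF wc, of "(u, 0, 0)" for u] by (simp add: weakly_converges_def)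
  have ws: "(\<lambda>n. (s (r n))\<^sup>2) \<longlonglongrightarrow> \<sigma>"
    using weakly_convergesD[OF wc, of "(0, 1, 0)"] by simp
  have wv: "weakly_converges (v \<circ> r) vt"
    using weakly_convergesD[OF wc, of "(0, 0, u)" for u] by (simp add: weakly_converges_def)
  have pr: "(\<lambda>n. p (r n)) \<longlonglongrightarrow> 0" using LIMSEQ_subseq_LIMSEQ[OF p0 r] by (simp add: o_def)
  have wQ: "weakly_converges (\<lambda>n. Q (r n)) (L xt)"
    using weakly_converges_add_null[OF weakly_converges_bounded_linear[OF L wX] pr]
    by (simp add: p_def)
  \<comment> \<open>Keeping the proximal term in the limit is the point: optimality of
    \<open>xb\<close> then forces \<sigma> to vanish, so \<open>X\<close> converges strongly to
    \<open>xb\<close> along the subsequence and the product of the two moving factors in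
    \<open>key\<close> has a limit.\<close>
  have "(xt, L xt) \<in> D \<times> E \<and> F (fst (xt, L xt)) + G (snd (xt, L xt)) \<le> P - 1/2 * \<sigma>"
  proof (rule closed_convex_weak_limit[OF closed_convex_separable_sum[OF F G]])
    show "weakly_converges (\<lambda>n. (X (r n), Q (r n))) (xt, L xt)"
      using wX wQ by (auto simp: weakly_converges_def intro: tendsto_add)
    show "(\<lambda>n. P - 1/2 * (s (r n))\<^sup>2) \<longlonglongrightarrow> P - 1/2 * \<sigma>" by (intro tendsto_intros ws)
    have "F (X n) + G (Q n) \<le> P - 1/2 * (s n)\<^sup>2" for n
    proof -
      have "0 \<le> real (Suc n)/2 * (norm (p n))\<^sup>2" by simp
      with min0[of n] show ?thesis by linarith
    qed
    then show "eventually (\<lambda>n. (X (r n), Q (r n)) \<in> D \<times> E \<and>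
        F (fst (X (r n), Q (r n))) + G (snd (X (r n), Q (r n))) \<le> P - 1/2 * (s (r n))\<^sup>2) sequentially"
      using XQ by simp
  qed
  with opt[of xt] have "\<sigma> \<le> 0" by (simp add: P_def)
  moreover have "0 \<le> \<sigma>" using ws by (rule tendsto_lowerbound) auto
  ultimately have "(\<lambda>n. sqrt ((s (r n))\<^sup>2)) \<longlonglongrightarrow> sqrt 0" using tendsto_real_sqrt[OF ws] by simp
  then have "(\<lambda>n. X (r n) - xb) \<longlonglongrightarrow> 0" by (simp add: s_def tendsto_norm_zero_iff)
  then have Xr: "(\<lambda>n. X (r n)) \<longlonglongrightarrow> xb" by (simp add: LIM_zero_iff)
  have Qr: "(\<lambda>n. Q (r n)) \<longlonglongrightarrow> L xb"
    using tendsto_add[OF L.tendsto[OF Xr] pr] by (simp add: p_def)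
  have vr: "(\<lambda>n. v (r n) \<bullet> u) \<longlonglongrightarrow> vt \<bullet> u" for u
    using weakly_convergesD[OF wv, of u] by simp
  \<comment> \<open>This joint inequality separates: \<open>b = xb\<close> gives the subgradient of
    \<open>G\<close>, and \<open>a = L xb\<close> gives the inequality for \<open>F\<close>.\<close>
  have fin: "P \<le> F b + G a - vt \<bullet> (a - L b)" if "a \<in> E" "b \<in> D" for a b
  proof -
    have "(xb, L xb) \<in> D \<times> E \<and> F (fst (xb, L xb)) + G (snd (xb, L xb))
        \<le> F b + G a + (xb - xb) \<bullet> (b - xb) - vt \<bullet> (a - L b)"
    proof (rule closed_convex_limit[OF closed_convex_separable_sum[OF F G]])
      show "(\<lambda>n. (X (r n), Q (r n))) \<longlonglongrightarrow> (xb, L xb)" by (intro tendsto_Pair Xr Qr)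
      show "(\<lambda>n. F b + G a + (X (r n) - xb) \<bullet> (b - X (r n)) - v (r n) \<bullet> (a - L b))
          \<longlonglongrightarrow> F b + G a + (xb - xb) \<bullet> (b - xb) - vt \<bullet> (a - L b)"
        by (rule tendsto_diff[OF _ vr]) (intro tendsto_intros Xr)
    qed (use key[OF that] XQ in simp)
    then show ?thesis by (simp add: P_def)
  qed
  have "subgradient E G (L xb) vt"
    using fin[OF _ xb(1)] xb(2) by (auto simp: subgradient_def P_def algebra_simps)
  moreover have "F xb - vt \<bullet> L (x - xb) \<le> F x" if "x \<in> D" for x
    using fin[OF xb(2) that] by (simp add: P_def L.diff inner_diff_right)
  ultimately show ?thesis by blast
qed

section \<open>Inertial Krasnoselskii--Mann iterations\<close>

lemma tendsto_zero_contraction: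
  fixes e r :: "nat \<Rightarrow> real"
  assumes e: "\<And>n. 0 \<le> e n" and q: "0 \<le> q" "q < 1"
    and step: "\<And>n. e (Suc n) \<le> q * e n + r n" and r: "r \<longlonglongrightarrow> 0"
  shows "e \<longlonglongrightarrow> 0"
proof (rule LIMSEQ_I)
  fix \<epsilon> :: real assume eps: "\<epsilon> > 0"
  \<comment> \<open>With perturbations below this size, \<open>\<epsilon> / 2\<close> is the fixed
    point of the affine recursion, so the remaining error decays like \<open>q ^ k\<close>.\<close>
  have "\<epsilon> / 2 * (1 - q) > 0" using eps q by simp
  then obtain N where N: "\<And>n. n \<ge> N \<Longrightarrow> r n < \<epsilon> / 2 * (1 - q)"
    using LIMSEQ_D[OF r] by fastforce
  have bd: "e (N + k) \<le> q ^ k * e N + \<epsilon> / 2" for k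
  proof (induction k)
    case 0
    then show ?case using eps by simp
  next
    case (Suc k)
    have "e (N + Suc k) \<le> q * e (N + k) + \<epsilon> / 2 * (1 - q)"
      using step[of "N + k"] N[of "N + k"] by simp
    also have "\<dots> \<le> q * (q ^ k * e N + \<epsilon> / 2) + \<epsilon> / 2 * (1 - q)"
      using Suc q by (intro add_right_mono mult_left_mono) auto
    finally show ?case by (simp add: field_simps)
  qed
  have "(\<lambda>k. q ^ k * e N) \<longlonglongrightarrow> 0 * e N"
    using q by (intro tendsto_intros LIMSEQ_realpow_zero) auto
  then have "eventually (\<lambda>k. q ^ k * e N < \<epsilon> / 2) sequentially"
    using eps by (intro order_tendstoD(2)) auto
  then obtain K where K: "\<And>k. k \<ge> K \<Longrightarrow> q ^ k * e N < \<epsilon> / 2"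
    by (auto simp: eventually_sequentially)
  show "\<exists>no. \<forall>n\<ge>no. norm (e n - 0) < \<epsilon>"
  proof (intro exI[of _ "N + K"] allI impI)
    fix n assume "N + K \<le> n"
    then have "K \<le> n - N" "N + (n - N) = n" by auto
    then have "e n < \<epsilon>"
      using bd[of "n - N"] K[of "n - N"] by simp
    with e[of n] show "norm (e n - 0) < \<epsilon>" by simp
  qed
qed

lemma tendsto_scaleR_bounded_zero:
  fixes X :: "nat \<Rightarrow> 'a::real_normed_vector"
  assumes "a \<longlonglongrightarrow> (0::real)" "bounded (range X)"
  shows "(\<lambda>n. a n *\<^sub>R X n) \<longlonglongrightarrow> 0"
proof -
  obtain B where "\<And>n. norm (X n) \<le> B" using assms(2) by (auto simp: bounded_iff)
  then have "Bfun X sequentially" by (auto intro!: BfunI always_eventually)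
  with assms(1) show ?thesis
    by (auto simp: tendsto_Zfun_iff intro: bounded_bilinear.Zfun_prod_Bfun[OF bounded_bilinear_scaleR])
qed

lemma tendsto_inner_bounded_zero:
  fixes X Y :: "nat \<Rightarrow> 'a::real_inner"
  assumes "X \<longlonglongrightarrow> 0" "bounded (range Y)"
  shows "(\<lambda>n. X n \<bullet> Y n) \<longlonglongrightarrow> 0"
proof -
  obtain B where "\<And>n. norm (Y n) \<le> B" using assms(2) by (auto simp: bounded_iff)
  then have "Bfun Y sequentially" by (auto intro!: BfunI always_eventually)
  with assms(1) show ?thesis
    by (auto simp: tendsto_Zfun_iff intro: bounded_bilinear.Zfun_prod_Bfun[OF bounded_bilinear_inner])
qed

text \<open>The energy \<mu> decreases and is bounded below, so its decrements, and with them
  \<open>t\<close>, tend to zero. This leaves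
  \<open>\<phi> (Suc n) = b * \<phi> n + m + o(1)\<close> with \<open>b\<close> the limit of
  \<open>a\<close> and \<open>m\<close> that of \<mu>, a perturbed contraction with fixed point
  \<open>m / (1 - b)\<close>.\<close>

lemma inertial_lyapunov_convergence:
  fixes \<phi> a t :: "nat \<Rightarrow> real"
  assumes \<phi>: "\<And>n. 0 \<le> \<phi> n" and t: "\<And>n. 0 \<le> t n"
    and a: "\<And>n. 0 \<le> a n" "\<And>n. a n \<le> \<alpha>" "incseq a" "\<alpha> < 1"
    and \<Gamma>: "0 \<le> \<Gamma>" and \<sigma>: "0 < \<sigma>"
    and step: "\<And>n. \<phi> (Suc (Suc n)) - a (Suc n) * \<phi> (Suc n) + \<Gamma> * t (Suc n)
        \<le> \<phi> (Suc n) - a n * \<phi> n + \<Gamma> * t n - \<sigma> * t (Suc n)"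
  shows "t \<longlonglongrightarrow> 0" "convergent \<phi>"
proof -
  define \<mu> where "\<mu> n = \<phi> (Suc n) - a n * \<phi> n + \<Gamma> * t n" for n
  have mstep: "\<mu> (Suc n) \<le> \<mu> n - \<sigma> * t (Suc n)" for n using step[of n] by (simp add: \<mu>_def)
  have dec: "decseq \<mu>"
    by (rule decseq_SucI) (use mstep t \<sigma> in \<open>smt (verit) mult_nonneg_nonneg\<close>)
  have al: "0 \<le> \<alpha>" using a(1)[of 0] a(2)[of 0] by linarith
  \<comment> \<open>An invariant bound: the second entry of the maximum gives
    \<open>\<bar>\<mu> 0\<bar> \<le> (1 - \<alpha>) * C\<close>, so a step from below
    \<open>C\<close> stays below \<open>\<alpha> * C + (1 - \<alpha>) * C\<close>.\<close>
  define C where "C = max (\<phi> 0) (\<bar>\<mu> 0\<bar> / (1 - \<alpha>))"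
  have bd: "\<phi> n \<le> C" for n
  proof (induction n)
    case 0
    then show ?case by (simp add: C_def)
  next
    case (Suc n)
    have "\<mu> n \<le> \<mu> 0" using dec by (simp add: decseq_def)
    then have "\<phi> (Suc n) \<le> a n * \<phi> n + \<bar>\<mu> 0\<bar>"
      using mult_nonneg_nonneg[OF \<Gamma> t[of n]] by (simp add: \<mu>_def)
    also have "\<dots> \<le> \<alpha> * C + (1 - \<alpha>) * C"
    proof (rule add_mono)
      show "a n * \<phi> n \<le> \<alpha> * C" using a Suc \<phi> al by (intro mult_mono) auto
      have "\<bar>\<mu> 0\<bar> / (1 - \<alpha>) \<le> C" by (simp add: C_def)
      then show "\<bar>\<mu> 0\<bar> \<le> (1 - \<alpha>) * C" using a(4) by (simp add: field_simps)
    qed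
    finally show ?case by (simp add: algebra_simps)
  qed
  have lower: "- (\<alpha> * C) \<le> \<mu> n" for n
  proof -
    have "a n * \<phi> n \<le> \<alpha> * C" using a bd[of n] \<phi> al by (intro mult_mono) auto
    then show ?thesis using \<phi>[of "Suc n"] mult_nonneg_nonneg[OF \<Gamma> t[of n]] by (simp add: \<mu>_def)
  qed
  obtain m where m: "\<mu> \<longlonglongrightarrow> m" using decseq_convergent[OF dec] lower by metis
  have "(\<lambda>n. t (Suc n)) \<longlonglongrightarrow> 0"
  proof (rule tendsto_sandwich[where f = "\<lambda>_. 0" and h = "\<lambda>n. (\<mu> n - \<mu> (Suc n)) / \<sigma>"])
    show "eventually (\<lambda>n. t (Suc n) \<le> (\<mu> n - \<mu> (Suc n)) / \<sigma>) sequentially"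
      using mstep \<sigma> by (intro always_eventually) (simp add: field_simps)
    have "(\<lambda>n. (\<mu> n - \<mu> (Suc n)) / \<sigma>) \<longlonglongrightarrow> (m - m) / \<sigma>"
      using \<sigma> by (intro tendsto_intros m LIMSEQ_Suc[OF m]) auto
    then show "(\<lambda>n. (\<mu> n - \<mu> (Suc n)) / \<sigma>) \<longlonglongrightarrow> 0" by simp
  qed (use t in auto)
  then show t0: "t \<longlonglongrightarrow> 0" by (rule LIMSEQ_imp_Suc)
  obtain b where b: "a \<longlonglongrightarrow> b" using incseq_convergent[OF a(3)] a(2) by metis
  have b01: "0 \<le> b" "b < 1"
    using tendsto_lowerbound[OF b, of 0] tendsto_upperbound[OF b, of \<alpha>] a by auto
  define c where "c = m / (1 - b)"
  define r where "r n = \<bar>\<mu> n - \<Gamma> * t n - m + (a n - b) * \<phi> n\<bar>" for n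
  have "(\<lambda>n. \<bar>\<phi> n - c\<bar>) \<longlonglongrightarrow> 0"
  proof (rule tendsto_zero_contraction[OF _ b01])
    show "\<bar>\<phi> (Suc n) - c\<bar> \<le> b * \<bar>\<phi> n - c\<bar> + r n" for n
    proof -
      have "m = (1 - b) * c" using b01 by (simp add: c_def)
      then have "\<phi> (Suc n) - c = b * (\<phi> n - c) + (\<mu> n - \<Gamma> * t n - m + (a n - b) * \<phi> n)"
        by (simp add: \<mu>_def algebra_simps)
      then show ?thesis
        using abs_triangle_ineq[of "b * (\<phi> n - c)" "\<mu> n - \<Gamma> * t n - m + (a n - b) * \<phi> n"] b01
        by (simp add: r_def abs_mult)
    qed
    have "(\<lambda>n. (a n - b) * \<phi> n) \<longlonglongrightarrow> 0"
    proof -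
      have "bounded (range \<phi>)" using bd \<phi> by (auto simp: bounded_iff intro: exI[of _ C])
      from tendsto_scaleR_bounded_zero[OF LIM_zero[OF b] this] show ?thesis by simp
    qed
    then have "(\<lambda>n. \<bar>\<mu> n - \<Gamma> * t n - m + (a n - b) * \<phi> n\<bar>) \<longlonglongrightarrow> \<bar>m - \<Gamma> * 0 - m + 0\<bar>"
      by (intro tendsto_intros m t0)
    then show "r \<longlonglongrightarrow> 0" by (simp add: r_def[abs_def])
  qed simp
  then show "convergent \<phi>"
    by (metis LIM_zero_cancel convergentI tendsto_rabs_zero_cancel)
qed

text \<open>The Fejer estimate leaves a gain of \<open>l * (2 - l)\<close> times the squared norm of
  \<open>d\<close>. Rewriting \<open>l *\<^sub>R d\<close> as the new increment minus
  \<open>a\<close> times the old one turns this gain into control of the new increment, at the cost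
  of a multiple of the old.\<close>

lemma inertial_step_inequality:
  fixes w0 w1 w2 d ws :: "'a::real_inner"
  assumes w2: "w2 = w1 + a *\<^sub>R (w1 - w0) + l *\<^sub>R d"
    and fejer: "(w1 + a *\<^sub>R (w1 - w0) - ws) \<bullet> d \<le> - (norm d)\<^sup>2"
    and a: "0 \<le> a" "a \<le> \<alpha>" and l: "0 < l" and \<delta>: "0 < \<delta>" and \<sigma>: "0 < \<sigma>"
    and bound: "l \<le> 2 * ((\<delta> - \<alpha> * (\<alpha> * (1 + \<alpha>) + \<alpha> * \<delta> + \<sigma>))
                        / (\<delta> * (1 + \<alpha> * (1 + \<alpha>) + \<alpha> * \<delta> + \<sigma>)))"
  shows "(norm (w2 - ws))\<^sup>2 \<le> (1 + a) * (norm (w1 - ws))\<^sup>2 - a * (norm (w0 - ws))\<^sup>2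
      + (\<alpha> * (1 + \<alpha>) + \<alpha> * \<delta>) * (norm (w1 - w0))\<^sup>2
      - (\<alpha> * (1 + \<alpha>) + \<alpha> * \<delta> + \<sigma>) * (norm (w2 - w1))\<^sup>2"
proof -
  define \<Gamma> where "\<Gamma> = \<alpha> * (1 + \<alpha>) + \<alpha> * \<delta>"
  define D0 D1 where "D0 = w1 - w0" and "D1 = w2 - w1"
  define \<rho> where "\<rho> = l / 2"
  \<comment> \<open>\<open>b\<close> is the weight in Young's inequality \<open>2 \<langle>D1, D0\<rangle> \<le> |D1|\<^sup>2 / b + b |D0|\<^sup>2\<close> below. It is chosen so
    that \<open>1 - a / b\<close> and \<open>a - b\<close> are both multiples of \<open>\<delta> \<rho>\<close>, which cancels the \<open>\<rho>\<close> from \<open>|d|\<^sup>2\<close>.\<close>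
  define b where "b = a + \<delta> * \<rho>"
  have al: "0 \<le> \<alpha>" using a by linarith
  have \<Gamma>: "0 \<le> \<Gamma>" using al \<delta> by (simp add: \<Gamma>_def)
  have \<rho>: "\<rho> > 0" using l by (simp add: \<rho>_def)
  have b: "b > 0" using a \<rho> \<delta> by (simp add: b_def add_nonneg_pos)
  have "\<rho> \<le> (\<delta> - \<alpha> * (\<Gamma> + \<sigma>)) / (\<delta> * (1 + \<Gamma> + \<sigma>))"
  proof -
    have *: "\<Gamma> + \<sigma> = \<alpha> * (1 + \<alpha>) + \<alpha> * \<delta> + \<sigma>"
      "1 + \<Gamma> + \<sigma> = 1 + \<alpha> * (1 + \<alpha>) + \<alpha> * \<delta> + \<sigma>" by (simp_all add: \<Gamma>_def)
    show ?thesis using bound unfolding \<rho>_def * by linarith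
  qed
  moreover have "\<delta> * (1 + \<Gamma> + \<sigma>) > 0" using \<delta> \<Gamma> \<sigma> by simp
  ultimately have "\<rho> * (\<delta> * (1 + \<Gamma> + \<sigma>)) \<le> \<delta> - \<alpha> * (\<Gamma> + \<sigma>)" by (simp add: pos_le_divide_eq)
  moreover have "a * (\<Gamma> + \<sigma>) \<le> \<alpha> * (\<Gamma> + \<sigma>)" using a \<Gamma> \<sigma> by (intro mult_right_mono) auto
  \<comment> \<open>Origin of the upper bound on \<open>l\<close>: it is this inequality with
    \<open>a\<close> replaced by \<alpha>, solved for \<rho>.\<close>
  ultimately have coef: "b * (\<Gamma> + \<sigma>) \<le> \<delta> * (1 - \<rho>)" by (simp add: b_def algebra_simps)
  have \<rho>1: "0 \<le> 1 - \<rho>"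
  proof -
    have "0 \<le> \<delta> * (1 - \<rho>)" using coef b \<Gamma> \<sigma> by (smt (verit) mult_nonneg_nonneg)
    then show ?thesis using \<delta> by (simp add: zero_le_mult_iff)
  qed
  have ld: "l *\<^sub>R d = D1 - a *\<^sub>R D0" using w2 by (simp add: D0_def D1_def)
  have p: "(norm (w1 + a *\<^sub>R D0 - ws))\<^sup>2 = (1 + a) * (norm (w1 - ws))\<^sup>2 - a * (norm (w0 - ws))\<^sup>2
      + a * (1 + a) * (norm D0)\<^sup>2"
  proof -
    have "w1 + a *\<^sub>R D0 - ws = (w1 - ws) + a *\<^sub>R D0" "w0 - ws = (w1 - ws) - D0"
      by (auto simp: D0_def)
    then show ?thesis by (simp only: norm_add_sq norm_diff_sq)
        (simp add: power_mult_distrib algebra_simps power2_eq_square)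
  qed
  have "w2 - ws = (w1 + a *\<^sub>R D0 - ws) + l *\<^sub>R d" using w2 by (simp add: D0_def)
  then have "(norm (w2 - ws))\<^sup>2 = (norm (w1 + a *\<^sub>R D0 - ws))\<^sup>2
      + 2 * (l * ((w1 + a *\<^sub>R D0 - ws) \<bullet> d)) + l\<^sup>2 * (norm d)\<^sup>2"
    by (simp only: norm_add_sq) (simp add: power_mult_distrib)
  moreover have "l * ((w1 + a *\<^sub>R D0 - ws) \<bullet> d) \<le> l * (- (norm d)\<^sup>2)"
    using fejer l by (intro mult_left_mono) (auto simp: D0_def)
  ultimately have 1: "(norm (w2 - ws))\<^sup>2 \<le> (norm (w1 + a *\<^sub>R D0 - ws))\<^sup>2
      - 2 * l * (1 - \<rho>) * (norm d)\<^sup>2"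
    by (simp add: \<rho>_def algebra_simps power2_eq_square)
  have 2: "\<delta> * (1 - \<rho>) * ((norm D1)\<^sup>2 / b - a * (norm D0)\<^sup>2) \<le> 2 * l * (1 - \<rho>) * (norm d)\<^sup>2"
  proof -
    have n: "l\<^sup>2 * (norm d)\<^sup>2 = (norm D1)\<^sup>2 - 2 * a * (D1 \<bullet> D0) + a\<^sup>2 * (norm D0)\<^sup>2"
    proof -
      have "(norm (l *\<^sub>R d))\<^sup>2 = (norm (D1 - a *\<^sub>R D0))\<^sup>2" by (simp add: ld)
      then show ?thesis by (simp only: norm_diff_sq) (simp add: power_mult_distrib)
    qed
    have "0 \<le> (norm (D1 - b *\<^sub>R D0))\<^sup>2" by simp
    then have "2 * b * (D1 \<bullet> D0) \<le> (norm D1)\<^sup>2 + b\<^sup>2 * (norm D0)\<^sup>2"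
      unfolding norm_diff_sq by (simp add: power_mult_distrib)
    then have "2 * (D1 \<bullet> D0) \<le> (norm D1)\<^sup>2 / b + b * (norm D0)\<^sup>2"
      using b by (simp add: field_simps power2_eq_square)
    then have "a * (2 * (D1 \<bullet> D0)) \<le> a * ((norm D1)\<^sup>2 / b + b * (norm D0)\<^sup>2)"
      using a by (intro mult_left_mono)
    then have "(1 - a / b) * (norm D1)\<^sup>2 + a * (a - b) * (norm D0)\<^sup>2 \<le> l\<^sup>2 * (norm d)\<^sup>2"
      unfolding n by (simp add: algebra_simps power2_eq_square)
    moreover have "1 - a / b = \<delta> * \<rho> / b" using b by (simp add: b_def field_simps)
    moreover have "a - b = - \<delta> * \<rho>" by (simp add: b_def)
    ultimately have "\<rho> * (\<delta> * ((norm D1)\<^sup>2 / b - a * (norm D0)\<^sup>2)) \<le> \<rho> * (2 * l * (norm d)\<^sup>2)"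
      by (simp add: \<rho>_def algebra_simps power2_eq_square)
    then have "\<delta> * ((norm D1)\<^sup>2 / b - a * (norm D0)\<^sup>2) \<le> 2 * l * (norm d)\<^sup>2" using \<rho> by simp
    then have "(1 - \<rho>) * (\<delta> * ((norm D1)\<^sup>2 / b - a * (norm D0)\<^sup>2)) \<le> (1 - \<rho>) * (2 * l * (norm d)\<^sup>2)"
      using \<rho>1 by (rule mult_left_mono)
    then show ?thesis by (simp only: mult_ac)
  qed
  have 3: "(\<Gamma> + \<sigma>) * (norm D1)\<^sup>2 \<le> \<delta> * (1 - \<rho>) * ((norm D1)\<^sup>2 / b)"
  proof -
    have "b * (\<Gamma> + \<sigma>) * ((norm D1)\<^sup>2 / b) \<le> \<delta> * (1 - \<rho>) * ((norm D1)\<^sup>2 / b)"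
      using coef b by (intro mult_right_mono) auto
    then show ?thesis using b by simp
  qed
  \<comment> \<open>Origin of \<Gamma>: \<open>\<alpha> * (1 + \<alpha>)\<close> bounds the term
    from expanding the extrapolated point, \<open>\<alpha> * \<delta>\<close> the remainder from
    Young's inequality.\<close>
  have 4: "(a * (1 + a) + \<delta> * (1 - \<rho>) * a) * (norm D0)\<^sup>2 \<le> \<Gamma> * (norm D0)\<^sup>2"
  proof (rule mult_right_mono)
    have "a * (1 + a) \<le> \<alpha> * (1 + \<alpha>)" using a by (intro mult_mono) auto
    moreover have "\<delta> * (1 - \<rho>) * a \<le> \<delta> * 1 * \<alpha>" using a \<delta> \<rho> \<rho>1 by (intro mult_mono) auto
    ultimately show "a * (1 + a) + \<delta> * (1 - \<rho>) * a \<le> \<Gamma>" by (simp add: \<Gamma>_def mult.commute)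
  qed simp
  show ?thesis
    using 1 2 3 4 unfolding p D0_def[symmetric] D1_def[symmetric] \<Gamma>_def[symmetric]
    by (simp add: algebra_simps)
qed

lemma inertial_iteration:
  fixes w d :: "nat \<Rightarrow> 'a::real_inner"
  assumes w: "\<And>n. w (Suc (Suc n)) = w (Suc n) + a n *\<^sub>R (w (Suc n) - w n) + l n *\<^sub>R d n"
    and fejer: "\<And>n. (w (Suc n) + a n *\<^sub>R (w (Suc n) - w n) - ws) \<bullet> d n \<le> - (norm (d n))\<^sup>2"
    and a: "\<And>n. 0 \<le> a n" "\<And>n. a n \<le> \<alpha>" "incseq a" "\<alpha> < 1"
    and \<delta>: "0 < \<delta>" and \<sigma>: "0 < \<sigma>" and l: "\<And>n. 0 < l n"
    and bound: "\<And>n. l n \<le> 2 * ((\<delta> - \<alpha> * (\<alpha> * (1 + \<alpha>) + \<alpha> * \<delta> + \<sigma>))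
                        / (\<delta> * (1 + \<alpha> * (1 + \<alpha>) + \<alpha> * \<delta> + \<sigma>)))"
  shows "(\<lambda>n. w (Suc n) - w n) \<longlonglongrightarrow> 0" "convergent (\<lambda>n. (norm (w n - ws))\<^sup>2)"
proof -
  define \<Gamma> where "\<Gamma> = \<alpha> * (1 + \<alpha>) + \<alpha> * \<delta>"
  have al: "0 \<le> \<alpha>" using a(1)[of 0] a(2)[of 0] by linarith
  have \<Gamma>: "0 \<le> \<Gamma>" using al \<delta> by (simp add: \<Gamma>_def)
  have step: "(norm (w (Suc (Suc n)) - ws))\<^sup>2 - a (Suc n) * (norm (w (Suc n) - ws))\<^sup>2
        + \<Gamma> * (norm (w (Suc (Suc n)) - w (Suc n)))\<^sup>2
      \<le> (norm (w (Suc n) - ws))\<^sup>2 - a n * (norm (w n - ws))\<^sup>2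
        + \<Gamma> * (norm (w (Suc n) - w n))\<^sup>2 - \<sigma> * (norm (w (Suc (Suc n)) - w (Suc n)))\<^sup>2" for n
  proof -
    \<comment> \<open>Monotonicity of \<open>a\<close> shifts the index of the coefficient, so that
      both sides become consecutive values of the same energy.\<close>
    have "a n * (norm (w (Suc n) - ws))\<^sup>2 \<le> a (Suc n) * (norm (w (Suc n) - ws))\<^sup>2"
      using a(3) by (intro mult_right_mono) (auto simp: incseq_SucD)
    then show ?thesis
      using inertial_step_inequality[OF w fejer a(1,2) l \<delta> \<sigma> bound, of n, folded \<Gamma>_def]
      by (simp add: algebra_simps)
  qed
  note conv = inertial_lyapunov_convergence[of "\<lambda>n. (norm (w n - ws))\<^sup>2"
      "\<lambda>n. (norm (w (Suc n) - w n))\<^sup>2", OF _ _ a \<Gamma> \<sigma> step]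
  show "convergent (\<lambda>n. (norm (w n - ws))\<^sup>2)" by (rule conv(2)) auto
  have "(\<lambda>n. (norm (w (Suc n) - w n))\<^sup>2) \<longlonglongrightarrow> 0" by (rule conv(1)) auto
  from tendsto_real_sqrt[OF this] show "(\<lambda>n. w (Suc n) - w n) \<longlonglongrightarrow> 0"
    by (simp add: tendsto_norm_zero_iff)
qed

section \<open>The inertial splitting iteration\<close>

text \<open>The condition on \<open>F\<close> is \<open>- adjoint L v\<close> being a subgradient at
  \<open>x\<close>, with the adjoint moved to the other side of the inner product.\<close>

definition kkt_pair ::
  "'h set \<Rightarrow> ('h \<Rightarrow> real) \<Rightarrow> 'g set \<Rightarrow> ('g \<Rightarrow> real) \<Rightarrow> ('h::real_inner \<Rightarrow> 'g::real_inner) \<Rightarrow> 'h \<Rightarrow> 'g \<Rightarrow> bool"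
  where "kkt_pair D F E G L x v \<longleftrightarrow>
    x \<in> D \<and> (\<forall>x'\<in>D. F x - v \<bullet> L (x' - x) \<le> F x') \<and> subgradient E G (L x) v"

lemma norm_diff_sq_expand:
  fixes a b w :: "'a::real_inner"
  shows "(norm (w - a))\<^sup>2 - (norm (w - b))\<^sup>2 = (norm a)\<^sup>2 - (norm b)\<^sup>2 - 2 * (w \<bullet> (a - b))"
  by (simp add: norm_diff_sq inner_diff_right)

text \<open>The iterates from index 2 on, in Douglas--Rachford form. With the notation of the theorem,
  \<open>X n = x\<^sup>n\<^sup>+\<^sup>3\<close>, \<open>Y n = y\<^sup>n\<^sup>+\<^sup>2\<close>, \<open>V n = v\<^sup>n\<^sup>+\<^sup>2\<close>, \<open>Q n\<close> is the sum of the \<open>z\<close>- and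
  \<open>zbar\<close>-iterates of index \<open>n + 2\<close>, and \<open>W n = y\<^sup>n\<^sup>+\<^sup>1 + \<gamma> z\<^sup>n\<^sup>+\<^sup>1\<close>.\<close>

locale inertial_splitting =
  fixes D :: "'h::{real_inner,complete_space} set" and F :: "'h \<Rightarrow> real"
    and E :: "'g::{real_inner,complete_space} set" and G :: "'g \<Rightarrow> real"
    and L :: "'h \<Rightarrow> 'g" and \<theta> \<gamma> \<alpha> \<delta> \<sigma> lam :: real
    and X :: "nat \<Rightarrow> 'h" and Q Y V W :: "nat \<Rightarrow> 'g" and a l :: "nat \<Rightarrow> real"
  assumes F: "closed_convex D F" and G: "closed_convex E G" and L: "bounded_linear L"
    and \<theta>: "0 < \<theta>" "\<And>x. \<theta> * norm x \<le> norm (L x)"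
    and \<gamma>: "0 < \<gamma>" and \<delta>: "0 < \<delta>" and \<sigma>: "0 < \<sigma>" and lam: "0 < lam"
    and a: "\<And>n. 0 \<le> a n" "\<And>n. a n \<le> \<alpha>" "incseq a" "\<alpha> < 1"
    and l: "\<And>n. lam \<le> l n"
      "\<And>n. l n \<le> 2 * ((\<delta> - \<alpha> * (\<alpha> * (1 + \<alpha>) + \<alpha> * \<delta> + \<sigma>))
                        / (\<delta> * (1 + \<alpha> * (1 + \<alpha>) + \<alpha> * \<delta> + \<sigma>)))"
    and XD: "\<And>n. X n \<in> D"
    and sub_F: "\<And>n x'. x' \<in> D \<Longrightarrow> F (X n) - V n \<bullet> L (x' - X n) \<le> F x'"
    and sub_G: "\<And>n. subgradient E G (Q n) (Y n)"
    and W_step: "\<And>n. W (Suc (Suc n)) = W (Suc n) + a n *\<^sub>R (W (Suc n) - W n) + l n *\<^sub>R (V n - Y n)"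
    and W_eq: "\<And>n. W (Suc n) + a n *\<^sub>R (W (Suc n) - W n) = Y n + \<gamma> *\<^sub>R Q n"
    and V_eq: "\<And>n. V n = Y n + \<gamma> *\<^sub>R (L (X n) - Q n)"
    and kkt_exists: "\<exists>xs vs. kkt_pair D F E G L xs vs"
begin

interpretation L: bounded_linear L by (rule L)

abbreviation "kkt \<equiv> kkt_pair D F E G L"

lemma QE: "Q n \<in> E" using sub_G[of n] by (simp add: subgradient_def)

lemma gap_Y_nonneg:
  assumes "kkt xs vs" shows "0 \<le> (Y n - vs) \<bullet> (Q n - L xs)"
  using subgradient_monotone[OF sub_G] assms by (simp add: kkt_pair_def)

lemma gap_V_nonpos:
  assumes "kkt xs vs" shows "(V n - vs) \<bullet> (L (X n) - L xs) \<le> 0"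
proof -
  have "F (X n) - V n \<bullet> L (xs - X n) \<le> F xs" "F xs - vs \<bullet> L (X n - xs) \<le> F (X n)"
    using sub_F[of xs n] XD[of n] assms by (auto simp: kkt_pair_def)
  then show ?thesis by (simp add: L.diff inner_diff_left inner_diff_right)
qed

text \<open>An identity is kept because it is read in two ways: the signs of the two monotonicity
  gaps give the Fejer inequality, and conversely the vanishing residual forces the gap of
  \<open>Y\<close> to zero.\<close>

lemma gap_identity:
  "(Y n + \<gamma> *\<^sub>R Q n - (vs + \<gamma> *\<^sub>R L xs)) \<bullet> (V n - Y n) + (norm (V n - Y n))\<^sup>2
    = \<gamma> * ((V n - vs) \<bullet> (L (X n) - L xs)) - \<gamma> * ((Y n - vs) \<bullet> (Q n - L xs))"
proof -
  define A B C where "A = Y n - vs" and "B = Q n - L xs" and "C = L (X n) - L xs"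
  have 1: "Y n + \<gamma> *\<^sub>R Q n - (vs + \<gamma> *\<^sub>R L xs) = A + \<gamma> *\<^sub>R B"
    by (simp add: A_def B_def algebra_simps)
  have 2: "V n - Y n = \<gamma> *\<^sub>R (C - B)" by (simp add: V_eq B_def C_def)
  have 3: "V n - vs = A + \<gamma> *\<^sub>R (C - B)" by (simp add: V_eq A_def B_def C_def)
  show ?thesis
    unfolding 1 2 3 A_def[symmetric] B_def[symmetric] C_def[symmetric] power2_norm_eq_inner
    by (simp add: inner_add_left inner_diff_left inner_diff_right inner_commute algebra_simps)
qed

lemma fejer:
  assumes "kkt xs vs"
  shows "(Y n + \<gamma> *\<^sub>R Q n - (vs + \<gamma> *\<^sub>R L xs)) \<bullet> (V n - Y n) \<le> - (norm (V n - Y n))\<^sup>2"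
proof -
  have "\<gamma> * ((V n - vs) \<bullet> (L (X n) - L xs)) \<le> 0" "0 \<le> \<gamma> * ((Y n - vs) \<bullet> (Q n - L xs))"
    using gap_V_nonpos[OF assms] gap_Y_nonneg[OF assms] \<gamma> by (auto simp: mult_le_0_iff)
  then show ?thesis using gap_identity[of n vs xs] by linarith
qed

lemma W_convergence:
  assumes "kkt xs vs"
  shows "(\<lambda>n. W (Suc n) - W n) \<longlonglongrightarrow> 0" "convergent (\<lambda>n. (norm (W n - (vs + \<gamma> *\<^sub>R L xs)))\<^sup>2)"
proof -
  have l0: "0 < l n" for n using l(1)[of n] lam by linarith
  note it = inertial_iteration[OF W_step _ a \<delta> \<sigma> l0 l(2), of "vs + \<gamma> *\<^sub>R L xs", unfolded W_eq,
      OF fejer[OF assms]]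
  show "(\<lambda>n. W (Suc n) - W n) \<longlonglongrightarrow> 0" by (rule it(1))
  show "convergent (\<lambda>n. (norm (W n - (vs + \<gamma> *\<^sub>R L xs)))\<^sup>2)" by (rule it(2))
qed

lemma W_diff_tendsto: "(\<lambda>n. W (Suc n) - W n) \<longlonglongrightarrow> 0"
  using kkt_exists W_convergence by blast

lemma inertia_tendsto: "(\<lambda>n. a n *\<^sub>R (W (Suc n) - W n)) \<longlonglongrightarrow> 0"
proof (rule Lim_null_comparison)
  show "(\<lambda>n. norm (W (Suc n) - W n)) \<longlonglongrightarrow> 0" using W_diff_tendsto by (rule tendsto_norm_zero)
  have "a n \<le> 1" for n using a(2)[of n] a(4) by linarith
  then show "eventually (\<lambda>n. norm (a n *\<^sub>R (W (Suc n) - W n)) \<le> norm (W (Suc n) - W n)) sequentially"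
    using a(1) by (intro always_eventually allI) (simp add: mult_left_le_one_le)
qed

lemma residual_tendsto: "(\<lambda>n. V n - Y n) \<longlonglongrightarrow> 0"
proof (rule Lim_null_comparison)
  let ?S = "\<lambda>n. (W (Suc (Suc n)) - W (Suc n)) - a n *\<^sub>R (W (Suc n) - W n)"
  have "(\<lambda>n. norm (?S n) / lam) \<longlonglongrightarrow> norm ((0::'g) - 0) / lam"
    using lam by (intro tendsto_intros LIMSEQ_Suc[OF W_diff_tendsto] inertia_tendsto) auto
  then show "(\<lambda>n. norm (?S n) / lam) \<longlonglongrightarrow> 0" by simp
  show "eventually (\<lambda>n. norm (V n - Y n) \<le> norm (?S n) / lam) sequentially"
  proof (intro always_eventually allI)
    fix n
    have S: "?S n = l n *\<^sub>R (V n - Y n)" using W_step[of n] by (simp add: algebra_simps)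
    have "lam * norm (V n - Y n) \<le> \<bar>l n\<bar> * norm (V n - Y n)"
      using l(1)[of n] by (intro mult_right_mono) auto
    then show "norm (V n - Y n) \<le> norm (?S n) / lam"
      unfolding S norm_scaleR using lam by (simp add: pos_le_divide_eq mult.commute)
  qed
qed

section \<open>Boundedness of the iterates\<close>

lemma W_bounded: "bounded (range W)"
proof -
  obtain xs vs where k: "kkt xs vs" using kkt_exists by blast
  let ?ws = "vs + \<gamma> *\<^sub>R L xs"
  have "Bseq (\<lambda>n. (norm (W n - ?ws))\<^sup>2)"
    using W_convergence(2)[OF k] by (rule convergent_imp_Bseq)
  then obtain B where B: "\<And>n. (norm (W n - ?ws))\<^sup>2 \<le> B" by (auto simp: Bseq_def)
  have "norm (W n) \<le> sqrt B + norm ?ws" for n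
    using real_le_rsqrt[OF B[of n]] norm_triangle_ineq[of "W n - ?ws" ?ws] by simp
  then show ?thesis by (auto simp: bounded_iff)
qed

text \<open>Monotonicity makes the cross term nonnegative when the square of \<open>Y n - vs\<close>
  plus \<gamma> times \<open>Q n - L xs\<close> is expanded, so \<open>Y n - vs\<close> is no longer
  than the bounded sum.\<close>

lemma Y_bounded: "bounded (range Y)"
proof -
  obtain xs vs where k: "kkt xs vs" using kkt_exists by blast
  let ?ws = "vs + \<gamma> *\<^sub>R L xs"
  have "bounded (range (\<lambda>n. W (Suc n)))" using W_bounded by (rule bounded_subset) auto
  then have "bounded (range (\<lambda>n. W (Suc n) + a n *\<^sub>R (W (Suc n) - W n)))"
    by (rule bounded_plus_comp) (rule convergent_imp_bounded[OF inertia_tendsto])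
  then obtain B where B: "\<And>n. norm (Y n + \<gamma> *\<^sub>R Q n) \<le> B" unfolding W_eq by (auto simp: bounded_iff)
  have "norm (Y n) \<le> B + norm ?ws + norm vs" for n
  proof -
    have "Y n + \<gamma> *\<^sub>R Q n - ?ws = (Y n - vs) + \<gamma> *\<^sub>R (Q n - L xs)" by (simp add: algebra_simps)
    then have "(norm (Y n + \<gamma> *\<^sub>R Q n - ?ws))\<^sup>2
        = (norm (Y n - vs))\<^sup>2 + 2 * (\<gamma> * ((Y n - vs) \<bullet> (Q n - L xs))) + (norm (\<gamma> *\<^sub>R (Q n - L xs)))\<^sup>2"
      by (simp only: norm_add_sq inner_scaleR_right)
    moreover have "0 \<le> \<gamma> * ((Y n - vs) \<bullet> (Q n - L xs))" using gap_Y_nonneg[OF k] \<gamma> by simp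
    ultimately have "(norm (Y n - vs))\<^sup>2 \<le> (norm (Y n + \<gamma> *\<^sub>R Q n - ?ws))\<^sup>2"
      using zero_le_power2[of "norm (\<gamma> *\<^sub>R (Q n - L xs))"] by linarith
    then have "norm (Y n - vs) \<le> norm (Y n + \<gamma> *\<^sub>R Q n - ?ws)"
      by (rule power2_le_imp_le) simp
    also have "\<dots> \<le> B + norm ?ws"
      using norm_triangle_ineq4[of "Y n + \<gamma> *\<^sub>R Q n" ?ws] B[of n] by linarith
    finally show ?thesis using norm_triangle_ineq[of "Y n - vs" vs] by simp
  qed
  then show ?thesis by (auto simp: bounded_iff)
qed

lemma LX_eq: "L (X n) = Q n + (1 / \<gamma>) *\<^sub>R (V n - Y n)"
  using \<gamma> by (simp add: V_eq)

lemma LX_sum: "Y n + \<gamma> *\<^sub>R L (X n) = W (Suc n) + (a n *\<^sub>R (W (Suc n) - W n) + (V n - Y n))"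
  using W_eq[of n] \<gamma> by (simp add: LX_eq algebra_simps)

lemma LX_bounded: "bounded (range (\<lambda>n. L (X n)))"
proof -
  have "bounded (range (\<lambda>n. W (Suc n)))" using W_bounded by (rule bounded_subset) auto
  then have "bounded (range (\<lambda>n. W (Suc n) + (a n *\<^sub>R (W (Suc n) - W n) + (V n - Y n))))"
    by (intro bounded_plus_comp convergent_imp_bounded[OF inertia_tendsto] convergent_imp_bounded[OF residual_tendsto])
  then have "bounded (range (\<lambda>n. (Y n + \<gamma> *\<^sub>R L (X n)) + (- 1) *\<^sub>R Y n))"
    unfolding LX_sum[symmetric] by (rule bounded_plus_comp) (rule bounded_scaleR_comp[OF Y_bounded])
  then have "bounded (range (\<lambda>n. \<gamma> *\<^sub>R L (X n)))" by simp
  from bounded_scaleR_comp[OF this, of "1 / \<gamma>"] show ?thesis using \<gamma> by simp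
qed

lemma X_bounded: "bounded (range X)"
proof -
  obtain B where B: "\<And>n. norm (L (X n)) \<le> B" using LX_bounded by (auto simp: bounded_iff)
  have "norm (X n) \<le> B / \<theta>" for n
    using \<theta>(2)[of "X n"] B[of n] \<theta>(1) by (simp add: field_simps)
  then show ?thesis by (auto simp: bounded_iff)
qed

text \<open>\<open>L (X n)\<close> and \<open>Q n\<close> differ by a multiple of the residual, so
  the difference of the products is a sum of products of the residual with bounded
  sequences.\<close>

lemma cross_term_tendsto: "(\<lambda>n. V n \<bullet> L (X n) - Y n \<bullet> Q n) \<longlonglongrightarrow> 0"
proof -
  have "V n \<bullet> L (X n) - Y n \<bullet> Q n = (V n - Y n) \<bullet> L (X n) + (1 / \<gamma>) * ((V n - Y n) \<bullet> Y n)" for n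
    by (simp add: LX_eq inner_add_right inner_diff_left inner_diff_right inner_commute algebra_simps)
  moreover have "(\<lambda>n. (V n - Y n) \<bullet> L (X n) + (1 / \<gamma>) * ((V n - Y n) \<bullet> Y n)) \<longlonglongrightarrow> 0 + (1 / \<gamma>) * 0"
    by (intro tendsto_intros tendsto_inner_bounded_zero residual_tendsto LX_bounded Y_bounded)
  ultimately show ?thesis by simp
qed

lemma value_bound:
  assumes "x' \<in> D" "q' \<in> E"
  shows "F (X n) + G (Q n) \<le> F x' + G q' + (V n - Y n) \<bullet> L x' + Y n \<bullet> (L x' - q')
      - (V n \<bullet> L (X n) - Y n \<bullet> Q n)"
proof -
  have "G (Q n) + Y n \<bullet> (q' - Q n) \<le> G q'" using sub_G[of n] assms(2) by (simp add: subgradient_def)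
  with sub_F[OF assms(1), of n] show ?thesis
    by (simp add: L.diff inner_diff_left inner_diff_right)
qed

text \<open>Adding the two subgradient inequalities turns the nonconvergent terms into
  \<open>\<langle>y, L x' - q'\<rangle>\<close> plus null sequences, so that weak lower semicontinuity of the separable sum
  suffices to pass to the limit.\<close>

lemma cluster_point_kkt:
  assumes r: "strict_mono r" and X: "weakly_converges (X \<circ> r) xt" and Y: "weakly_converges (Y \<circ> r) vt"
  shows "kkt xt vt"
proof -
  have res: "(\<lambda>n. V (r n) - Y (r n)) \<longlonglongrightarrow> 0"
    using LIMSEQ_subseq_LIMSEQ[OF residual_tendsto r] by (simp add: o_def)
  have cross: "(\<lambda>n. V (r n) \<bullet> L (X (r n)) - Y (r n) \<bullet> Q (r n)) \<longlonglongrightarrow> 0"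
    using LIMSEQ_subseq_LIMSEQ[OF cross_term_tendsto r] by (simp add: o_def)
  have Qw: "weakly_converges (\<lambda>n. Q (r n)) (L xt)"
  proof -
    have "(\<lambda>n. (- 1 / \<gamma>) *\<^sub>R (V (r n) - Y (r n))) \<longlonglongrightarrow> (- 1 / \<gamma>) *\<^sub>R 0"
      by (intro tendsto_intros res)
    then have "(\<lambda>n. (- 1 / \<gamma>) *\<^sub>R (V (r n) - Y (r n))) \<longlonglongrightarrow> 0" by simp
    from weakly_converges_add_null[OF weakly_converges_bounded_linear[OF L X] this]
    show ?thesis by (simp add: LX_eq)
  qed
  have Yr: "(\<lambda>n. Y (r n) \<bullet> u) \<longlonglongrightarrow> vt \<bullet> u" for u using weakly_convergesD[OF Y, of u] by simp
  have fin: "xt \<in> D \<and> L xt \<in> E \<and> F xt + G (L xt) \<le> F x' + G q' + vt \<bullet> (L x' - q')"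
    if "x' \<in> D" "q' \<in> E" for x' q'
  proof -
    have "(xt, L xt) \<in> D \<times> E \<and> F (fst (xt, L xt)) + G (snd (xt, L xt))
        \<le> F x' + G q' + 0 \<bullet> L x' + vt \<bullet> (L x' - q') - 0"
    proof (rule closed_convex_weak_limit[OF closed_convex_separable_sum[OF F G]])
      show "weakly_converges (\<lambda>n. (X (r n), Q (r n))) (xt, L xt)"
        using X Qw by (auto simp: weakly_converges_def intro: tendsto_add)
      show "(\<lambda>n. F x' + G q' + (V (r n) - Y (r n)) \<bullet> L x' + Y (r n) \<bullet> (L x' - q')
          - (V (r n) \<bullet> L (X (r n)) - Y (r n) \<bullet> Q (r n)))
          \<longlonglongrightarrow> F x' + G q' + 0 \<bullet> L x' + vt \<bullet> (L x' - q') - 0"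
        by (rule tendsto_diff[OF tendsto_add[OF _ Yr] cross]) (intro tendsto_intros res)
    qed (use value_bound[OF that] XD QE in simp)
    then show ?thesis by simp
  qed
  have dom: "xt \<in> D" "L xt \<in> E" using fin[OF XD QE] by auto
  \<comment> \<open>Fixing \<open>q' = L xt\<close> or \<open>x' = xt\<close> splits the joint
    inequality into the two optimality conditions.\<close>
  show ?thesis unfolding kkt_pair_def subgradient_def
    using dom fin[OF _ dom(2)] fin[OF dom(1)] by (auto simp: L.diff inner_diff_right algebra_simps)
qed

text \<open>Equality of the combinations makes the dual difference a negative multiple of the
  difference of the images; monotonicity then forces both to vanish, and the lower bound on
  \<open>L\<close> separates the primal points.\<close>

lemma kkt_unique:
  assumes k: "kkt x1 v1" "kkt x2 v2" and eq: "v1 + \<gamma> *\<^sub>R L x1 = v2 + \<gamma> *\<^sub>R L x2"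
  shows "x1 = x2 \<and> v1 = v2"
proof -
  have "v1 - v2 = - (\<gamma> *\<^sub>R (L x1 - L x2))" using eq by (simp add: algebra_simps)
  moreover have "0 \<le> (v1 - v2) \<bullet> (L x1 - L x2)"
    using subgradient_monotone k by (auto simp: kkt_pair_def)
  ultimately have "\<gamma> * ((L x1 - L x2) \<bullet> (L x1 - L x2)) \<le> 0" by simp
  then have "L x1 - L x2 = 0"
    using \<gamma> by (metis inner_eq_zero_iff inner_ge_zero mult_le_0_iff not_less order_antisym)
  then have "L (x1 - x2) = 0" "v1 = v2" using eq by (auto simp: L.diff)
  then show ?thesis using \<theta>(2)[of "x1 - x2"] \<theta>(1) by (simp add: mult_le_0_iff)
qed

lemma cluster_point_W:
  assumes r: "strict_mono r" and X: "weakly_converges (X \<circ> r) xt" and Y: "weakly_converges (Y \<circ> r) vt"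
  shows "weakly_converges (\<lambda>n. W (Suc (r n))) (vt + \<gamma> *\<^sub>R L xt)"
proof -
  have "(\<lambda>n. - (a n *\<^sub>R (W (Suc n) - W n) + (V n - Y n))) \<longlonglongrightarrow> - (0 + 0)"
    by (intro tendsto_intros inertia_tendsto residual_tendsto)
  then have "(\<lambda>n. - (a n *\<^sub>R (W (Suc n) - W n) + (V n - Y n))) \<longlonglongrightarrow> 0" by simp
  then have null: "(\<lambda>n. - (a (r n) *\<^sub>R (W (Suc (r n)) - W (r n)) + (V (r n) - Y (r n)))) \<longlonglongrightarrow> 0"
    using LIMSEQ_subseq_LIMSEQ[OF _ r] by (force simp: o_def)
  have "weakly_converges (\<lambda>n. \<gamma> *\<^sub>R L (X (r n))) (\<gamma> *\<^sub>R L xt)"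
    using weakly_converges_bounded_linear[OF bounded_linear_compose[OF bounded_linear_scaleR_right L] X, of \<gamma>]
    by simp
  from weakly_converges_add_null[OF weakly_converges_add[OF Y this] null]
  show ?thesis by (simp add: LX_sum)
qed

text \<open>Opial's argument: the difference of the squared distances to \<open>w1\<close> and
  \<open>w2\<close> converges, hence so do the products of \<open>W n\<close> with
  \<open>w1 - w2\<close>. Both cluster points must give the same limit, so \<open>w1 - w2\<close> is
  orthogonal to itself.\<close>

lemma cluster_point_unique:
  assumes r1: "strict_mono r1" and X1: "weakly_converges (X \<circ> r1) x1" and Y1: "weakly_converges (Y \<circ> r1) v1"
    and r2: "strict_mono r2" and X2: "weakly_converges (X \<circ> r2) x2" and Y2: "weakly_converges (Y \<circ> r2) v2"
  shows "x1 = x2 \<and> v1 = v2"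
proof -
  define w1 w2 where "w1 = v1 + \<gamma> *\<^sub>R L x1" and "w2 = v2 + \<gamma> *\<^sub>R L x2"
  have k: "kkt x1 v1" "kkt x2 v2" using cluster_point_kkt assms by auto
  have "convergent (\<lambda>n. (norm (W n - w1))\<^sup>2 - (norm (W n - w2))\<^sup>2)"
    unfolding w1_def w2_def by (intro convergent_diff W_convergence(2) k)
  then obtain c where "(\<lambda>n. (norm (W n - w1))\<^sup>2 - (norm (W n - w2))\<^sup>2) \<longlonglongrightarrow> c"
    by (auto simp: convergent_def)
  then have "(\<lambda>n. ((norm w1)\<^sup>2 - (norm w2)\<^sup>2 - ((norm (W n - w1))\<^sup>2 - (norm (W n - w2))\<^sup>2)) / 2)
      \<longlonglongrightarrow> ((norm w1)\<^sup>2 - (norm w2)\<^sup>2 - c) / 2" by (intro tendsto_intros) auto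
  then have lim: "(\<lambda>n. W n \<bullet> (w1 - w2)) \<longlonglongrightarrow> ((norm w1)\<^sup>2 - (norm w2)\<^sup>2 - c) / 2"
    by (simp add: norm_diff_sq_expand)
  have sub: "w \<bullet> (w1 - w2) = ((norm w1)\<^sup>2 - (norm w2)\<^sup>2 - c) / 2"
    if "strict_mono r" "weakly_converges (\<lambda>n. W (Suc (r n))) w" for r w
  proof -
    have "strict_mono (\<lambda>n. Suc (r n))" using that(1) by (simp add: strict_mono_def)
    from LIMSEQ_subseq_LIMSEQ[OF lim this] weakly_convergesD[OF that(2), of "w1 - w2"]
    show ?thesis by (auto simp: o_def dest: LIMSEQ_unique)
  qed
  have "w1 \<bullet> (w1 - w2) = w2 \<bullet> (w1 - w2)"
    using sub[OF r1, of w1] sub[OF r2, of w2] cluster_point_W[OF r1 X1 Y1] cluster_point_W[OF r2 X2 Y2]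
    by (simp add: w1_def w2_def)
  then have "w1 = w2" by (metis eq_iff_diff_eq_0 inner_diff_left inner_eq_zero_iff)
  then show ?thesis using kkt_unique[OF k] by (simp add: w1_def w2_def)
qed

lemma weak_convergence:
  "\<exists>xb vb. kkt xb vb \<and> weakly_converges X xb \<and> weakly_converges Y vb"
proof -
  have fstw: "weakly_converges (X \<circ> s) (fst p)" and sndw: "weakly_converges (Y \<circ> s) (snd p)"
    if "weakly_converges ((\<lambda>n. (X n, Y n)) \<circ> s) p" for s p
    using weakly_convergesD[OF that, of "(u, 0)" for u] weakly_convergesD[OF that, of "(0, u)" for u]
    by (auto simp: weakly_converges_def inner_prod_def)
  obtain B1 B2 where "\<And>n. norm (X n) \<le> B1" "\<And>n. norm (Y n) \<le> B2"
    using X_bounded Y_bounded by (auto simp: bounded_iff)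
  then have "norm (X n, Y n) \<le> B1 + B2" for n
    using norm_Pair_le[of "X n" "Y n"] by (meson add_mono order_trans)
  then have bd: "bounded (range (\<lambda>n. (X n, Y n)))" by (auto simp: bounded_iff)
  then obtain r p where r: "strict_mono r" and p: "weakly_converges ((\<lambda>n. (X n, Y n)) \<circ> r) p"
    using bounded_imp_weakly_convergent_subseq by blast
  have "weakly_converges (\<lambda>n. (X n, Y n)) p"
  proof (rule weakly_converges_if_unique_cluster_point[OF bd])
    fix s p' assume s: "strict_mono s" "weakly_converges ((\<lambda>n. (X n, Y n)) \<circ> s) p'"
    show "p' = p"
      using cluster_point_unique[OF s(1) fstw[OF s(2)] sndw[OF s(2)] r fstw[OF p] sndw[OF p]]
      by (simp add: prod_eq_iff)
  qed
  then have "weakly_converges ((\<lambda>n. (X n, Y n)) \<circ> id) p" by simp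
  from fstw[OF this] sndw[OF this] cluster_point_kkt[OF r fstw[OF p] sndw[OF p]]
  show ?thesis by auto
qed

text \<open>The upper estimate uses the subgradients at the iterates, the lower one those at the
  solution. Both errors are governed by the residual, so strong convergence of the iterates is not
  involved.\<close>

lemma value_tendsto:
  assumes k: "kkt xb vb"
  shows "(\<lambda>n. F (X n) + G (Q n)) \<longlonglongrightarrow> F xb + G (L xb)"
proof (rule tendsto_sandwich)
  let ?u = "\<lambda>n. F xb + G (L xb) + (V n - Y n) \<bullet> L xb - (V n \<bullet> L (X n) - Y n \<bullet> Q n)"
  let ?l = "\<lambda>n. F xb + G (L xb) - (1 / \<gamma>) * ((V n - Y n) \<bullet> vb)"
  have dom: "xb \<in> D" "L xb \<in> E" using k by (auto simp: kkt_pair_def subgradient_def)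
  show "eventually (\<lambda>n. F (X n) + G (Q n) \<le> ?u n) sequentially"
    using value_bound[OF dom] by simp
  have "?l n \<le> F (X n) + G (Q n)" for n
  proof -
    have "F xb - vb \<bullet> L (X n - xb) \<le> F (X n)" "G (L xb) + vb \<bullet> (Q n - L xb) \<le> G (Q n)"
      using k XD QE by (auto simp: kkt_pair_def subgradient_def)
    then show ?thesis
      by (simp add: L.diff LX_eq inner_diff_left inner_diff_right inner_add_right inner_commute)
  qed
  then show "eventually (\<lambda>n. ?l n \<le> F (X n) + G (Q n)) sequentially" by simp
  have "?u \<longlonglongrightarrow> F xb + G (L xb) + 0 \<bullet> L xb - 0"
    by (rule tendsto_diff[OF _ cross_term_tendsto]) (intro tendsto_intros residual_tendsto)
  then show "?u \<longlonglongrightarrow> F xb + G (L xb)" by simp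
  have "?l \<longlonglongrightarrow> F xb + G (L xb) - (1 / \<gamma>) * (0 \<bullet> vb)"
    by (intro tendsto_intros residual_tendsto)
  then show "?l \<longlonglongrightarrow> F xb + G (L xb)" by simp
qed

text \<open>In the gap identity the other gap is nonpositive, so this one is bounded by products of
  the residual with bounded sequences. It is the quantity that a uniformly convex conjugate turns
  into a distance.\<close>

lemma gap_Y_tendsto:
  assumes k: "kkt xb vb"
  shows "(\<lambda>n. (Y n - vb) \<bullet> (Q n - L xb)) \<longlonglongrightarrow> 0"
proof (rule Lim_null_comparison)
  let ?d = "\<lambda>n. V n - Y n"
  let ?U = "\<lambda>n. - (?d n \<bullet> (Y n + \<gamma> *\<^sub>R Q n - (vb + \<gamma> *\<^sub>R L xb)) + ?d n \<bullet> ?d n) / \<gamma>"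
  have "bounded (range (\<lambda>n. (W (Suc n) + a n *\<^sub>R (W (Suc n) - W n)) + - (vb + \<gamma> *\<^sub>R L xb)))"
    using W_bounded
    by (intro bounded_plus_comp convergent_imp_bounded[OF inertia_tendsto] convergent_imp_bounded[OF tendsto_const])
      (auto intro: bounded_subset)
  then have "bounded (range (\<lambda>n. Y n + \<gamma> *\<^sub>R Q n - (vb + \<gamma> *\<^sub>R L xb)))"
    by (simp only: W_eq add_uminus_conv_diff)
  then have "?U \<longlonglongrightarrow> - (0 + 0) / \<gamma>" using \<gamma>
    by (intro tendsto_divide tendsto_minus tendsto_add tendsto_const tendsto_inner_bounded_zero
        residual_tendsto convergent_imp_bounded[OF residual_tendsto]) auto
  then show "?U \<longlonglongrightarrow> 0" by simp
  show "eventually (\<lambda>n. norm ((Y n - vb) \<bullet> (Q n - L xb)) \<le> ?U n) sequentially"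
  proof (intro always_eventually allI)
    fix n
    have "\<gamma> * ((V n - vb) \<bullet> (L (X n) - L xb)) \<le> 0"
      using gap_V_nonpos[OF k] \<gamma> by (simp add: mult_le_0_iff)
    then have "\<gamma> * ((Y n - vb) \<bullet> (Q n - L xb))
        \<le> - (?d n \<bullet> (Y n + \<gamma> *\<^sub>R Q n - (vb + \<gamma> *\<^sub>R L xb)) + ?d n \<bullet> ?d n)"
      using gap_identity[of n vb xb] by (simp add: inner_commute[of "?d n"] dot_square_norm)
    then have "(Y n - vb) \<bullet> (Q n - L xb) \<le> ?U n"
      using \<gamma> by (simp only: pos_le_divide_eq mult.commute)
    then show "norm ((Y n - vb) \<bullet> (Q n - L xb)) \<le> ?U n" using gap_Y_nonneg[OF k, of n] by simp
  qed
qed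

end

section \<open>Extended-real-valued functions\<close>

text \<open>Infinite values are sent to 0, so this is meaningful only on
  \<open>eff_dom f\<close>.\<close>

abbreviation fin_part :: "('a \<Rightarrow> ereal) \<Rightarrow> 'a \<Rightarrow> real" where
  "fin_part f x \<equiv> real_of_ereal (f x)"

lemma Gamma_class_finite:
  assumes "f \<in> Gamma_class" "x \<in> eff_dom f"
  shows "f x = ereal (fin_part f x)"
proof -
  have "f x \<noteq> -\<infinity>" "f x \<noteq> \<infinity>" using assms by (auto simp: Gamma_class_def proper_fun_def eff_dom_def)
  then show ?thesis by (cases "f x") auto
qed

lemma not_eff_dom: "x \<notin> eff_dom f \<Longrightarrow> f x = \<infinity>"
  by (simp add: eff_dom_def)

lemma Gamma_class_closed_convex:
  assumes f: "f \<in> Gamma_class"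
  shows "closed_convex (eff_dom f) (fin_part f)"
  unfolding closed_convex_def
proof (intro conjI allI)
  show "eff_dom f \<noteq> {}" using f by (auto simp: Gamma_class_def proper_fun_def eff_dom_def)
  have conv: "s *\<^sub>R x + t *\<^sub>R y \<in> eff_dom f \<and>
      fin_part f (s *\<^sub>R x + t *\<^sub>R y) \<le> s * fin_part f x + t * fin_part f y"
    if x: "x \<in> eff_dom f" and y: "y \<in> eff_dom f" and st: "0 \<le> s" "0 \<le> t" "s + t = 1" for x y s t
  \<comment> \<open>\<open>convex_fun\<close> speaks of weights strictly between 0 and 1; the
    endpoints are separate.\<close>
  proof (cases "s = 0 \<or> t = 0")
    case True
    then show ?thesis using x y st by auto
  next
    case False
    then have s: "s \<in> {0<..<1}" "t = 1 - s" using st by auto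
    have "f (s *\<^sub>R x + (1 - s) *\<^sub>R y) \<le> ereal s * f x + ereal (1 - s) * f y"
      using f s(1) by (auto simp: Gamma_class_def convex_fun_def)
    also have "\<dots> = ereal (s * fin_part f x + (1 - s) * fin_part f y)"
      by (subst Gamma_class_finite[OF f x], subst Gamma_class_finite[OF f y]) simp
    finally have le: "f (s *\<^sub>R x + t *\<^sub>R y) \<le> ereal (s * fin_part f x + t * fin_part f y)"
      by (simp add: s(2))
    then have m: "s *\<^sub>R x + t *\<^sub>R y \<in> eff_dom f"
      unfolding eff_dom_def mem_Collect_eq by (rule le_less_trans) simp
    with le Gamma_class_finite[OF f m] show ?thesis by (metis ereal_less_eq(3))
  qed
  show "convex_on (eff_dom f) (fin_part f)"
    unfolding convex_on_def convex_def using conv by blast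
  fix c
  have "open {x. ereal c < f x}"
  proof (rule openI)
    fix x assume x: "x \<in> {x. ereal c < f x}"
    have "f x \<le> Liminf (nhds x) f" using f by (simp add: Gamma_class_def lsc_fun_def)
    then have "eventually (\<lambda>y. ereal c < f y) (nhds x)" using x by (auto simp: le_Liminf_iff)
    then obtain S where "open S" "x \<in> S" "S \<subseteq> {x. ereal c < f x}"
      by (auto simp: eventually_nhds)
    then show "\<exists>e>0. ball x e \<subseteq> {x. ereal c < f x}" by (meson openE order_trans)
  qed
  moreover have "{x \<in> eff_dom f. fin_part f x \<le> c} = - {x. ereal c < f x}"
  proof (rule set_eqI)
    fix x show "x \<in> {x \<in> eff_dom f. fin_part f x \<le> c} \<longleftrightarrow> x \<in> - {x. ereal c < f x}"
    proof (cases "x \<in> eff_dom f")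
      case True
      have "(ereal c < f x) = (c < fin_part f x)"
        by (subst Gamma_class_finite[OF f True]) simp
      with True show ?thesis by auto
    next
      case False
      then show ?thesis using not_eff_dom[OF False] by simp
    qed
  qed
  ultimately show "closed {x \<in> eff_dom f. fin_part f x \<le> c}" by (simp add: closed_Compl)
qed

lemma Gamma_class_translate:
  assumes g: "g \<in> Gamma_class"
  shows "(\<lambda>w. g (w + c)) \<in> Gamma_class"
  unfolding Gamma_class_def mem_Collect_eq
proof (intro conjI)
  have "\<exists>x. g (x + c) \<noteq> \<infinity>"
    using g by (metis (mono_tags) Gamma_class_def diff_add_cancel mem_Collect_eq proper_fun_def)
  then show "proper_fun (\<lambda>w. g (w + c))" using g by (simp add: Gamma_class_def proper_fun_def)
  show "convex_fun (\<lambda>w. g (w + c))"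
    unfolding convex_fun_def
  proof (intro allI ballI)
    fix x y and t :: real assume t: "t \<in> {0<..<1}"
    have "t *\<^sub>R x + (1 - t) *\<^sub>R y + c = t *\<^sub>R (x + c) + (1 - t) *\<^sub>R (y + c)"
      by (simp add: algebra_simps)
    then show "g (t *\<^sub>R x + (1 - t) *\<^sub>R y + c) \<le> ereal t * g (x + c) + ereal (1 - t) * g (y + c)"
      using g t by (simp add: Gamma_class_def convex_fun_def)
  qed
  show "lsc_fun (\<lambda>w. g (w + c))"
    unfolding lsc_fun_def le_Liminf_iff
  proof (intro allI impI)
    fix x b assume b: "b < g (x + c)"
    have "g (x + c) \<le> Liminf (nhds (x + c)) g" using g by (simp add: Gamma_class_def lsc_fun_def)
    then have "eventually (\<lambda>y. b < g y) (nhds (x + c))" using b by (simp add: le_Liminf_iff)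
    moreover have "filterlim (\<lambda>w. w + c) (nhds (x + c)) (nhds x)"
      by (intro tendsto_intros filterlim_ident)
    ultimately show "eventually (\<lambda>w. b < g (w + c)) (nhds x)"
      by (rule eventually_compose_filterlim)
  qed
qed

text \<open>\<open>ARG_MIN\<close> is a choice and says something only when a minimizer exists; the
  real-valued existence result supplies one, after which the chosen point inherits the first-order
  condition.\<close>

lemma arg_min_quadratic_subgradient:
  fixes f :: "'a::{real_inner,complete_space} \<Rightarrow> ereal" and K :: "'a \<Rightarrow> 'b::real_inner"
  assumes f: "f \<in> Gamma_class" and l: "bounded_linear l" and K: "bounded_linear K"
    and th: "\<theta> > 0" "\<And>x. norm (K x) \<ge> \<theta> * norm x" and g: "\<gamma> > 0"
    and u: "u = (ARG_MIN (\<lambda>x. f x + ereal (l x) + ereal (\<gamma> / 2 * (norm (K x - b))\<^sup>2)) x. True)"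
  shows "u \<in> eff_dom f"
    and "y \<in> eff_dom f \<Longrightarrow>
      fin_part f u - l (y - u) - \<gamma> * ((K u - b) \<bullet> K (y - u)) \<le> fin_part f y"
proof -
  define \<Psi> where "\<Psi> x = f x + ereal (l x) + ereal (\<gamma> / 2 * (norm (K x - b))\<^sup>2)" for x
  note cc = Gamma_class_closed_convex[OF f]
  have fin: "\<Psi> x = ereal (fin_part f x + l x + \<gamma> / 2 * (norm (K x - b))\<^sup>2)" if "x \<in> eff_dom f" for x
    unfolding \<Psi>_def by (subst Gamma_class_finite[OF f that]) simp
  have inf: "\<Psi> x = \<infinity>" if "x \<notin> eff_dom f" for x
    using not_eff_dom[OF that] by (simp add: \<Psi>_def)
  obtain u0 where u0: "u0 \<in> eff_dom f" and "\<And>y. y \<in> eff_dom f \<Longrightarrow> \<Psi> u0 \<le> \<Psi> y"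
    using minimizer_quadratic_exists[OF cc l K th g, of b] by (auto simp: fin)
  then have "\<Psi> u0 \<le> \<Psi> y" for y using inf by (cases "y \<in> eff_dom f") auto
  then have "is_arg_min \<Psi> (\<lambda>_. True) u0" by (simp add: is_arg_min_linorder)
  then have "is_arg_min \<Psi> (\<lambda>_. True) u"
    unfolding u arg_min_def \<Psi>_def[symmetric] by (rule someI)
  then have min: "\<Psi> u \<le> \<Psi> y" for y by (simp add: is_arg_min_linorder)
  show ud: "u \<in> eff_dom f" using min[of u0] inf[of u] fin[OF u0] by force
  have min': "fin_part f u + l u + \<gamma> / 2 * (norm (K u - b))\<^sup>2
      \<le> fin_part f y + l y + \<gamma> / 2 * (norm (K y - b))\<^sup>2" if "y \<in> eff_dom f" for y
    using min[of y] by (simp add: fin ud that)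
  show "fin_part f u - l (y - u) - \<gamma> * ((K u - b) \<bullet> K (y - u)) \<le> fin_part f y"
    if "y \<in> eff_dom f"
    by (rule minimizer_quadratic_subgradient[OF cc l K ud that min'])
qed

section \<open>Subgradients and conjugates\<close>

lemma subgradient_imp_subdiff:
  assumes f: "f \<in> Gamma_class" and s: "subgradient (eff_dom f) (fin_part f) x v"
  shows "v \<in> subdiff f x"
proof -
  have x: "x \<in> eff_dom f" using s by (simp add: subgradient_def)
  note fx = Gamma_class_finite[OF f x]
  have "f y \<ge> f x + ereal (v \<bullet> (y - x))" for y
  proof (cases "y \<in> eff_dom f")
    case True
    have "fin_part f x + v \<bullet> (y - x) \<le> fin_part f y" using s True by (simp add: subgradient_def)
    then have "ereal (fin_part f x) + ereal (v \<bullet> (y - x)) \<le> ereal (fin_part f y)" by simp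
    then show ?thesis by (simp only: fx[symmetric] Gamma_class_finite[OF f True, symmetric])
  qed (simp add: not_eff_dom)
  moreover have "\<bar>f x\<bar> \<noteq> \<infinity>" by (subst fx) simp
  ultimately show ?thesis by (simp add: subdiff_def)
qed

lemma fenchel_young:
  assumes "f \<in> Gamma_class" "x \<in> eff_dom f"
  shows "ereal (u \<bullet> x - fin_part f x) \<le> conj_fun f u"
proof -
  have "ereal (u \<bullet> x) - f x \<le> conj_fun f u" unfolding conj_fun_def by (rule SUP_upper) simp
  then show ?thesis by (subst (asm) Gamma_class_finite[OF assms]) simp
qed

lemma conj_fun_subgradient:
  assumes f: "f \<in> Gamma_class" and s: "subgradient (eff_dom f) (fin_part f) x v"
  shows "conj_fun f v = ereal (v \<bullet> x - fin_part f x)"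
proof (rule antisym)
  show "ereal (v \<bullet> x - fin_part f x) \<le> conj_fun f v"
    using s by (intro fenchel_young[OF f]) (simp add: subgradient_def)
  show "conj_fun f v \<le> ereal (v \<bullet> x - fin_part f x)"
    unfolding conj_fun_def
  proof (rule SUP_least)
    fix y
    show "ereal (v \<bullet> y) - f y \<le> ereal (v \<bullet> x - fin_part f x)"
    proof (cases "y \<in> eff_dom f")
      case True
      have "fin_part f x + v \<bullet> (y - x) \<le> fin_part f y" using s True by (simp add: subgradient_def)
      then show ?thesis by (subst Gamma_class_finite[OF f True]) (simp add: inner_diff_right)
    qed (simp add: not_eff_dom)
  qed
qed

lemma subgradient_if_conj_fun_le:
  assumes f: "f \<in> Gamma_class" and x: "x \<in> eff_dom f"
    and le: "conj_fun f v \<le> ereal (v \<bullet> x - fin_part f x)"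
  shows "subgradient (eff_dom f) (fin_part f) x v"
  unfolding subgradient_def
proof (intro conjI ballI x)
  fix y assume "y \<in> eff_dom f"
  from order_trans[OF fenchel_young[OF f this] le]
  show "fin_part f x + v \<bullet> (y - x) \<le> fin_part f y" by (simp add: inner_diff_right)
qed

text \<open>Uniform convexity is used at the midpoint of \<open>y\<close> and \<open>v\<close>. At
  the endpoints Fenchel-Young holds with equality, at the midpoint as an inequality against both
  \<open>q\<close> and \<open>r\<close>; averaging leaves a quarter of the inner product, matching
  the factor \<open>1/4\<close> of \<phi>.\<close>

lemma uniformly_convex_conj_gap:
  assumes g: "g \<in> Gamma_class"
    and uc: "\<And>x y t. x \<in> eff_dom (conj_fun g) \<Longrightarrow> y \<in> eff_dom (conj_fun g) \<Longrightarrow> t \<in> {0<..<1} \<Longrightarrow>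
        conj_fun g (t *\<^sub>R x + (1 - t) *\<^sub>R y) + ereal (t * (1 - t)) * \<phi> (norm (x - y))
          \<le> ereal t * conj_fun g x + ereal (1 - t) * conj_fun g y"
    and s: "subgradient (eff_dom g) (fin_part g) q y" "subgradient (eff_dom g) (fin_part g) r v"
    and nonneg: "0 \<le> \<phi> (norm (y - v))"
  shows "\<phi> (norm (y - v)) \<le> ereal ((y - v) \<bullet> (q - r))"
proof -
  define m where "m = (1/2) *\<^sub>R y + (1 - 1/2) *\<^sub>R v"
  note cy = conj_fun_subgradient[OF g s(1)] and cv = conj_fun_subgradient[OF g s(2)]
  have "conj_fun g m + ereal (1/2 * (1 - 1/2)) * \<phi> (norm (y - v))
      \<le> ereal (1/2) * conj_fun g y + ereal (1 - 1/2) * conj_fun g v"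
    unfolding m_def by (rule uc) (auto simp: eff_dom_def cy cv)
  also have "\<dots> = ereal (1/2 * (y \<bullet> q - fin_part g q) + 1/2 * (v \<bullet> r - fin_part g r))"
    by (simp add: cy cv)
  finally have up: "conj_fun g m + ereal (1/4) * \<phi> (norm (y - v))
      \<le> ereal (1/2 * (y \<bullet> q - fin_part g q) + 1/2 * (v \<bullet> r - fin_part g r))" by simp
  have lo: "ereal (m \<bullet> q - fin_part g q) \<le> conj_fun g m" "ereal (m \<bullet> r - fin_part g r) \<le> conj_fun g m"
    using s by (auto intro!: fenchel_young[OF g] simp: subgradient_def)
  obtain c where c: "conj_fun g m = ereal c"
    \<comment> \<open>Finiteness at the midpoint: Fenchel-Young rules out minus infinity, and the
      convexity bound with nonnegative \<phi> rules out infinity.\<close>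
    using lo(1) up nonneg by (cases "conj_fun g m"; cases "\<phi> (norm (y - v))") auto
  show ?thesis
  proof (cases "\<phi> (norm (y - v))")
    case (real p)
    have "c + 1/4 * p \<le> 1/2 * (y \<bullet> q - fin_part g q) + 1/2 * (v \<bullet> r - fin_part g r)"
      using up by (simp add: c real)
    moreover have "m \<bullet> q - fin_part g q \<le> c" "m \<bullet> r - fin_part g r \<le> c" using lo by (auto simp: c)
    ultimately show ?thesis
      by (simp add: real m_def inner_add_left inner_diff_left inner_diff_right field_simps)
  qed (use up c nonneg in auto)
qed

lemma weakly_converges_offset:
  assumes "weakly_converges (\<lambda>n. X (n + k)) l"
  shows "weakly_converges X l"
  unfolding weakly_converges_def
  using weakly_convergesD[OF assms] by (blast intro: LIMSEQ_offset)

section \<open>Primal-dual pairs and strong duality\<close>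

lemma eff_dom_sum_iff:
  assumes "f \<in> Gamma_class" "g \<in> Gamma_class"
  shows "f x + g y < \<infinity> \<longleftrightarrow> x \<in> eff_dom f \<and> y \<in> eff_dom g"
proof -
  have "f x \<noteq> -\<infinity>" "g y \<noteq> -\<infinity>" using assms by (auto simp: Gamma_class_def proper_fun_def)
  then show ?thesis by (cases "f x"; cases "g y") (auto simp: eff_dom_def)
qed

lemma kkt_pair_exists:
  fixes f :: "'h::{real_inner,complete_space} \<Rightarrow> ereal"
    and g :: "'g::{real_inner,complete_space} \<Rightarrow> ereal"
  assumes f: "f \<in> Gamma_class" and g: "g \<in> Gamma_class" and L: "bounded_linear L"
    and sol: "primal_sol f g L xs"
    and qual: "0 \<in> sqri {a - L b | a b. a \<in> eff_dom g \<and> b \<in> eff_dom f}"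
  shows "\<exists>vs. kkt_pair (eff_dom f) (fin_part f) (eff_dom g) (fin_part g) L xs vs"
proof -
  define S where "S = {a - L b | a b. a \<in> eff_dom g \<and> b \<in> eff_dom f}"
  define V where "V = (\<Union>l\<in>{0<..}. {l *\<^sub>R (s - 0) | s. s \<in> S})"
  have V: "0 \<in> S" "subspace V" "closed V"
    using qual unfolding sqri_def S_def[symmetric] V_def by auto
  have val: "f xs + g (L xs) \<le> f x + g (L x)" for x
    using sol INF_lower[of x UNIV "primal_obj f g L"]
    unfolding primal_sol_def primal_val_def primal_obj_def by simp
  obtain b where b: "b \<in> eff_dom f" "L b \<in> eff_dom g"
    using V(1) by (auto simp: S_def)
  \<comment> \<open>\<open>primal_sol\<close> does not exclude an infinite optimal value; that zero
    belongs to \<open>S\<close> yields a feasible point, and so finiteness.\<close>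
  then have "f xs + g (L xs) < \<infinity>"
    using le_less_trans[OF val[of b]] eff_dom_sum_iff[OF f g] by blast
  then have xs: "xs \<in> eff_dom f" "L xs \<in> eff_dom g" using eff_dom_sum_iff[OF f g] by auto
  have "\<exists>v. subgradient (eff_dom g) (fin_part g) (L xs) v \<and>
      (\<forall>x\<in>eff_dom f. fin_part f xs - v \<bullet> L (x - xs) \<le> fin_part f x)"
  proof (rule dual_multiplier_exists[OF Gamma_class_closed_convex[OF f]
        Gamma_class_closed_convex[OF g] L xs _ V(2,3)])
    show "fin_part f xs + fin_part g (L xs) \<le> fin_part f x + fin_part g (L x)"
      if "x \<in> eff_dom f" "L x \<in> eff_dom g" for x
    proof -
      have "ereal (fin_part f xs) + ereal (fin_part g (L xs)) \<le> ereal (fin_part f x) + ereal (fin_part g (L x))"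
        using val[of x] by (simp only: Gamma_class_finite[OF f xs(1), symmetric]
            Gamma_class_finite[OF g xs(2), symmetric] Gamma_class_finite[OF f that(1), symmetric]
            Gamma_class_finite[OF g that(2), symmetric])
      then show ?thesis by simp
    qed
    show "a - L b \<in> V" if "a \<in> eff_dom g" "b \<in> eff_dom f" for a b
      unfolding V_def S_def using that by (intro UN_I[of 1]) auto
    show "\<exists>l>0. \<exists>a\<in>eff_dom g. \<exists>b\<in>eff_dom f. w = l *\<^sub>R (a - L b)" if "w \<in> V" for w
      using that unfolding V_def S_def by auto
  qed
  then show ?thesis using xs by (auto simp: kkt_pair_def)
qed

lemma kkt_pair_subdiff:
  fixes L :: "'h::{real_inner,complete_space} \<Rightarrow> 'g::real_inner"
  assumes L: "bounded_linear L"
    and x: "x \<in> eff_dom f" "\<And>x'. x' \<in> eff_dom f \<Longrightarrow> fin_part f x - v \<bullet> L (x' - x) \<le> fin_part f x'"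
  shows "subgradient (eff_dom f) (fin_part f) x (- adjoint L v)"
  using x by (auto simp: subgradient_def adjoint_works_complete[OF L])

text \<open>Fenchel-Young with equality at the pair closes the duality gap. Conversely, for any dual
  solution a zero gap leaves no slack in either Fenchel-Young inequality at \<open>xb\<close>, so
  every dual solution is a subgradient at the same point \<open>L xb\<close>.\<close>

lemma kkt_pair_optimal:
  fixes f :: "'h::{real_inner,complete_space} \<Rightarrow> ereal"
    and g :: "'g::{real_inner,complete_space} \<Rightarrow> ereal"
  assumes f: "f \<in> Gamma_class" and g: "g \<in> Gamma_class" and L: "bounded_linear L"
    and k: "kkt_pair (eff_dom f) (fin_part f) (eff_dom g) (fin_part g) L xb vb"
  defines "P \<equiv> fin_part f xb + fin_part g (L xb)"
  shows "primal_val f g L = ereal P" "dual_val f g L = ereal P"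
    "primal_sol f g L xb" "dual_sol f g L vb"
    "dual_sol f g L w \<Longrightarrow> subgradient (eff_dom g) (fin_part g) (L xb) w"
proof -
  note adj = adjoint_works_complete[OF L]
  interpret L: bounded_linear L by (rule L)
  have x: "xb \<in> eff_dom f" and sg: "subgradient (eff_dom g) (fin_part g) (L xb) vb"
    using k by (auto simp: kkt_pair_def)
  have Lx: "L xb \<in> eff_dom g" using sg by (simp add: subgradient_def)
  have sf: "subgradient (eff_dom f) (fin_part f) xb (- adjoint L vb)"
    using k by (intro kkt_pair_subdiff[OF L]) (auto simp: kkt_pair_def)
  have pxb: "primal_obj f g L xb = ereal P"
    unfolding primal_obj_def P_def
    by (subst Gamma_class_finite[OF f x], subst Gamma_class_finite[OF g Lx]) simp
  have plow: "ereal P \<le> primal_obj f g L x'" for x'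
  proof (cases "x' \<in> eff_dom f \<and> L x' \<in> eff_dom g")
    case True
    then have "fin_part f xb - vb \<bullet> L (x' - xb) \<le> fin_part f x'"
      "fin_part g (L xb) + vb \<bullet> (L x' - L xb) \<le> fin_part g (L x')"
      using k by (auto simp: kkt_pair_def subgradient_def)
    then have "P \<le> fin_part f x' + fin_part g (L x')" by (simp add: P_def L.diff)
    moreover have "primal_obj f g L x' = ereal (fin_part f x' + fin_part g (L x'))"
      unfolding primal_obj_def using True
      by (subst Gamma_class_finite[OF f], simp, subst Gamma_class_finite[OF g]) auto
    ultimately show ?thesis by simp
  next
    case False
    then have "primal_obj f g L x' = \<infinity>"
      using eff_dom_sum_iff[OF f g, of x' "L x'"] unfolding primal_obj_def by (metis ereal_infty_less(1))
    then show ?thesis by simp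
  qed
  show pv: "primal_val f g L = ereal P"
    unfolding primal_val_def
    using INF_lower[of xb UNIV "primal_obj f g L"] by (intro antisym INF_greatest plow) (simp add: pxb)
  then show "primal_sol f g L xb" by (simp add: primal_sol_def pxb)
  have dvb: "dual_obj f g L vb = ereal P"
    unfolding dual_obj_def conj_fun_subgradient[OF f sf] conj_fun_subgradient[OF g sg]
    by (simp add: P_def adj)
  have low: "ereal (- (w \<bullet> L xb) - fin_part f xb) \<le> conj_fun f (- adjoint L w)"
    "ereal (w \<bullet> L xb - fin_part g (L xb)) \<le> conj_fun g w" for w
    using fenchel_young[OF f x, of "- adjoint L w"] fenchel_young[OF g Lx, of w] by (auto simp: adj)
  have dup: "dual_obj f g L w \<le> ereal P" for w
    unfolding dual_obj_def using low[of w]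
    by (cases "conj_fun f (- adjoint L w)"; cases "conj_fun g w") (auto simp: P_def)
  show dv: "dual_val f g L = ereal P"
    unfolding dual_val_def
    using SUP_upper[of vb UNIV "dual_obj f g L"] by (intro antisym SUP_least dup) (simp add: dvb)
  then show "dual_sol f g L vb" by (simp add: dual_sol_def dvb)
  assume "dual_sol f g L w"
  then have "dual_obj f g L w = ereal P" by (simp add: dual_sol_def dv)
  then have "conj_fun g w \<le> ereal (w \<bullet> L xb - fin_part g (L xb))"
    unfolding dual_obj_def using low[of w]
    by (cases "conj_fun f (- adjoint L w)"; cases "conj_fun g w") (auto simp: P_def)
  then show "subgradient (eff_dom g) (fin_part g) (L xb) w"
    by (rule subgradient_if_conj_fun_le[OF g Lx])
qed

text \<open>The modulus at the distance to \<open>vb\<close> is bounded by the monotonicity gap. For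
  another dual solution paired with \<open>L xb\<close> the gap is zero; for the iterates it tends
  to zero, and a monotone modulus positive at \<open>e\<close> excludes distances of at least
  \<open>e\<close>.\<close>

lemma uniformly_convex_conj_strong_convergence:
  fixes f :: "'h::{real_inner,complete_space} \<Rightarrow> ereal"
    and g :: "'g::{real_inner,complete_space} \<Rightarrow> ereal"
  assumes f: "f \<in> Gamma_class" and g: "g \<in> Gamma_class" and L: "bounded_linear L"
    and k: "kkt_pair (eff_dom f) (fin_part f) (eff_dom g) (fin_part g) L xb vb"
    and uc: "uniformly_convex_fun (conj_fun g)"
    and s: "\<And>n. subgradient (eff_dom g) (fin_part g) (Q n) (Y n)"
    and gap: "(\<lambda>n. (Y n - vb) \<bullet> (Q n - L xb)) \<longlonglongrightarrow> 0"
  shows "dual_sol f g L w \<longleftrightarrow> w = vb" "Y \<longlonglongrightarrow> vb"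
proof -
  obtain \<phi> :: "real \<Rightarrow> ereal" where mono: "mono_on {0..} \<phi>"
    and \<phi>: "\<forall>s\<ge>0. 0 \<le> \<phi> s \<and> (\<phi> s = 0 \<longleftrightarrow> s = 0)"
    and ineq: "\<And>x y t. x \<in> eff_dom (conj_fun g) \<Longrightarrow> y \<in> eff_dom (conj_fun g) \<Longrightarrow> t \<in> {0<..<1} \<Longrightarrow>
        conj_fun g (t *\<^sub>R x + (1 - t) *\<^sub>R y) + ereal (t * (1 - t)) * \<phi> (norm (x - y))
          \<le> ereal t * conj_fun g x + ereal (1 - t) * conj_fun g y"
    using uc unfolding uniformly_convex_fun_def by blast
  have sv: "subgradient (eff_dom g) (fin_part g) (L xb) vb" using k by (simp add: kkt_pair_def)
  have bound: "\<phi> (norm (y - vb)) \<le> ereal ((y - vb) \<bullet> (q - L xb))"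
    if "subgradient (eff_dom g) (fin_part g) q y" for q y
    by (rule uniformly_convex_conj_gap[OF g ineq that sv]) (use \<phi> in auto)
  show "dual_sol f g L w \<longleftrightarrow> w = vb"
  proof
    assume "dual_sol f g L w"
    then have "subgradient (eff_dom g) (fin_part g) (L xb) w" by (rule kkt_pair_optimal(5)[OF f g L k])
    from bound[OF this] have "\<phi> (norm (w - vb)) \<le> 0" by (simp add: zero_ereal_def)
    then have "\<phi> (norm (w - vb)) = 0" using \<phi> by (simp add: antisym)
    then show "w = vb" using \<phi> by simp
  qed (use kkt_pair_optimal(4)[OF f g L k] in simp)
  show "Y \<longlonglongrightarrow> vb"
  proof (rule tendstoI)
    fix e :: real assume e: "e > 0"
    then have pos: "0 < \<phi> e" using \<phi> by (metis less_le less_imp_le)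
    have "(\<lambda>n. ereal ((Y n - vb) \<bullet> (Q n - L xb))) \<longlonglongrightarrow> ereal 0" using gap by simp
    then have "eventually (\<lambda>n. ereal ((Y n - vb) \<bullet> (Q n - L xb)) < \<phi> e) sequentially"
      using pos by (intro order_tendstoD(2)) (auto simp: zero_ereal_def)
    then show "eventually (\<lambda>n. dist (Y n) vb < e) sequentially"
    proof eventually_elim
      case (elim n)
      show ?case
      proof (rule ccontr)
        assume "\<not> dist (Y n) vb < e"
        then have "\<phi> e \<le> \<phi> (norm (Y n - vb))"
          using e by (intro mono_onD[OF mono]) (auto simp: dist_norm)
        with bound[OF s, of n] elim show False by (meson leD order_trans)
      qed
    qed
  qed
qed

theorem theorem9:
  fixes f :: "'h::{real_inner,complete_space} \<Rightarrow> ereal"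
    and g :: "'g::{real_inner,complete_space} \<Rightarrow> ereal"
    and L :: "'h \<Rightarrow> 'g"
    and x :: "nat \<Rightarrow> 'h"
    and y z zbar v :: "nat \<Rightarrow> 'g"
    and \<alpha>s lams :: "nat \<Rightarrow> real"
    and \<alpha> lam \<sigma> \<delta> \<gamma> :: real
  assumes "f \<in> Gamma_class" and "g \<in> Gamma_class" and "bounded_linear L"
    and "\<exists>x. primal_sol f g L x"
    and "0 \<in> sqri {a - L b | a b. a \<in> eff_dom g \<and> b \<in> eff_dom f}"
    and "\<exists>\<theta>>0. \<forall>x. norm (L x) \<ge> \<theta> * norm x"
    and "\<gamma> > 0"
    and "mono_on {1..} \<alpha>s"
    and "\<forall>k\<ge>2. 0 \<le> \<alpha>s k \<and> \<alpha>s k \<le> \<alpha>" and "\<alpha> < 1"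
    and "lam > 0" and "\<sigma> > 0" and "\<delta> > 0"
    and "\<delta> > (\<alpha>^2 * (1 + \<alpha>) + \<alpha> * \<sigma>) / (1 - \<alpha>^2)"
    and "\<forall>k\<ge>2. lam \<le> lams k \<and>
           lams k \<le> 2 * ((\<delta> - \<alpha> * (\<alpha> * (1 + \<alpha>) + \<alpha> * \<delta> + \<sigma>))
                        / (\<delta> * (1 + \<alpha> * (1 + \<alpha>) + \<alpha> * \<delta> + \<sigma>)))"
    and "\<alpha>s 2 = 0 \<or> (lams 1 = 0 \<and> \<alpha>s 1 = 0)"
    and x_step: "\<forall>k\<ge>1. x (k + 1) =
          (ARG_MIN (\<lambda>u. f u
               + ereal ((y k - \<alpha>s k *\<^sub>R (y k - y (k - 1))
                             - (\<gamma> * \<alpha>s k) *\<^sub>R (z k - z (k - 1))) \<bullet> L u)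
               + ereal (\<gamma> / 2 * (norm (L u - z k))^2)) u. True)"
    and zbar_step: "\<forall>k\<ge>1. zbar (k + 1) =
          (\<alpha>s (k + 1) * lams k) *\<^sub>R (L (x (k + 1)) - z k)
          + ((1 - lams k) * \<alpha>s k * \<alpha>s (k + 1) / \<gamma>) *\<^sub>R
              (y k - y (k - 1) + \<gamma> *\<^sub>R (z k - z (k - 1)))"
    and z_step: "\<forall>k\<ge>1. z (k + 1) =
          (ARG_MIN (\<lambda>w. g (w + zbar (k + 1))
               + ereal ((- y k - ((1 - lams k) * \<alpha>s k) *\<^sub>R
                             (y k - y (k - 1) + \<gamma> *\<^sub>R (z k - z (k - 1)))) \<bullet> w)
               + ereal (\<gamma> / 2 *
                   (norm (w - lams k *\<^sub>R L (x (k + 1)) - (1 - lams k) *\<^sub>R z k))^2)) w. True)"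
    and y_step: "\<forall>k\<ge>1. y (k + 1) =
          y k + \<gamma> *\<^sub>R (lams k *\<^sub>R L (x (k + 1)) + (1 - lams k) *\<^sub>R z k - z (k + 1))
          + ((1 - lams k) * \<alpha>s k) *\<^sub>R (y k - y (k - 1) + \<gamma> *\<^sub>R (z k - z (k - 1)))"
    and v_seq: "\<forall>k\<ge>1. v k =
          y k - \<gamma> *\<^sub>R z k + \<gamma> *\<^sub>R L (x (k + 1))
          - \<alpha>s k *\<^sub>R (y k - y (k - 1) + \<gamma> *\<^sub>R (z k - z (k - 1)))"
  shows "\<exists>xbar vbar.
      - adjoint L vbar \<in> subdiff f xbar \<and> vbar \<in> subdiff g (L xbar)
    \<and> primal_sol f g L xbar \<and> dual_sol f g L vbar \<and> primal_val f g L = dual_val f g L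
    \<and> weakly_converges x xbar
    \<and> zbar \<longlonglongrightarrow> 0
    \<and> weakly_converges z (L xbar)
    \<and> (\<lambda>k. L (x (k + 1)) - z k) \<longlonglongrightarrow> 0
    \<and> weakly_converges y vbar
    \<and> (uniformly_convex_fun (conj_fun g) \<longrightarrow>
         (\<exists>d. (\<forall>w. dual_sol f g L w \<longleftrightarrow> w = d) \<and> y \<longlonglongrightarrow> d))
    \<and> (\<lambda>k. f (x (k + 1)) + g (z k + zbar k)) \<longlonglongrightarrow> primal_val f g L
    \<and> (\<lambda>k. - conj_fun f (- adjoint L (v k)) - conj_fun g (y k)) \<longlonglongrightarrow> dual_val f g L
    \<and> weakly_converges v vbar"
proof -
  note f = assms(1) and g = assms(2) and L = assms(3) and \<gamma> = assms(7)
  interpret L: bounded_linear L by (rule L)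
  let ?D = "eff_dom f" and ?F = "fin_part f" and ?E = "eff_dom g" and ?G = "fin_part g"
  obtain xs where "primal_sol f g L xs" using assms(4) by blast
  then obtain vs where kkt_ex: "kkt_pair ?D ?F ?E ?G L xs vs"
    using kkt_pair_exists[OF f g L _ assms(5)] by blast
  obtain \<theta> where \<theta>: "\<theta> > 0" "\<And>x. norm (L x) \<ge> \<theta> * norm x" using assms(6) by blast
  define w where "w k = y k + \<gamma> *\<^sub>R z k" for k
  have w_diff: "y k - y (k - 1) + \<gamma> *\<^sub>R (z k - z (k - 1)) = w k - w (k - 1)" for k
    by (simp add: w_def algebra_simps)
  have v_eq: "v k = y k + \<gamma> *\<^sub>R (L (x (k + 1)) - z k) - \<alpha>s k *\<^sub>R (w k - w (k - 1))" if "k \<ge> 1" for k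
    using v_seq that unfolding w_diff by (simp add: scaleR_diff_right)
  have w_next: "w (k + 1) = w k + (\<gamma> * lams k) *\<^sub>R (L (x (k + 1)) - z k)
      + ((1 - lams k) * \<alpha>s k) *\<^sub>R (w k - w (k - 1))" if "k \<ge> 1" for k
  proof -
    have "y (k + 1) = y k + \<gamma> *\<^sub>R (lams k *\<^sub>R L (x (k + 1)) + (1 - lams k) *\<^sub>R z k - z (k + 1))
        + ((1 - lams k) * \<alpha>s k) *\<^sub>R (w k - w (k - 1))"
      using y_step that unfolding w_diff by blast
    then show ?thesis unfolding w_def[of "k + 1"] w_def[of k]
      by (simp add: algebra_simps)
  qed
  \<comment> \<open>The meaning of the correction \<open>zbar\<close>: scaled by \<gamma>, it is
    exactly the inertial increment of \<open>w\<close>. The factor \<open>lams k\<close> and its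
    complement only reproduce the previous step of \<open>w\<close>.\<close>
  have zbar_eq: "\<gamma> *\<^sub>R zbar (k + 1) = \<alpha>s (k + 1) *\<^sub>R (w (k + 1) - w k)" if "k \<ge> 1" for k
  proof -
    have "\<gamma> *\<^sub>R zbar (k + 1) = (\<gamma> * (\<alpha>s (k + 1) * lams k)) *\<^sub>R (L (x (k + 1)) - z k)
        + (\<gamma> * ((1 - lams k) * \<alpha>s k * \<alpha>s (k + 1) / \<gamma>)) *\<^sub>R (w k - w (k - 1))"
      using zbar_step that unfolding w_diff by (simp only: scaleR_add_right scaleR_scaleR)
    also have "\<gamma> * ((1 - lams k) * \<alpha>s k * \<alpha>s (k + 1) / \<gamma>) = \<alpha>s (k + 1) * ((1 - lams k) * \<alpha>s k)"
      using \<gamma> by simp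
    also have "\<gamma> * (\<alpha>s (k + 1) * lams k) = \<alpha>s (k + 1) * (\<gamma> * lams k)" by simp
    finally show ?thesis unfolding w_next[OF that]
      by (simp only: scaleR_scaleR[symmetric] scaleR_add_right[symmetric] add_diff_cancel_left' add.assoc)
  qed
  have x_dom: "x (k + 1) \<in> ?D"
    and x_sub: "\<And>x'. x' \<in> ?D \<Longrightarrow> ?F (x (k + 1)) - v k \<bullet> L (x' - x (k + 1)) \<le> ?F x'"
    if k: "k \<ge> 1" for k
  proof -
    define c where "c = y k - \<alpha>s k *\<^sub>R (y k - y (k - 1)) - (\<gamma> * \<alpha>s k) *\<^sub>R (z k - z (k - 1))"
    have l: "bounded_linear (\<lambda>u. c \<bullet> L u)"
      by (rule bounded_linear_compose[OF bounded_linear_inner_right L])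
    have xk: "x (k + 1) = (ARG_MIN (\<lambda>u. f u + ereal (c \<bullet> L u) + ereal (\<gamma> / 2 * (norm (L u - z k))\<^sup>2)) u. True)"
      using x_step k unfolding c_def by blast
    note am = arg_min_quadratic_subgradient[OF f l L \<theta> \<gamma> xk]
    show "x (k + 1) \<in> ?D" by (rule am(1))
    have vk: "v k = c + \<gamma> *\<^sub>R (L (x (k + 1)) - z k)"
      unfolding v_eq[OF k] w_diff[symmetric] c_def by (simp add: algebra_simps)
    show "?F (x (k + 1)) - v k \<bullet> L (x' - x (k + 1)) \<le> ?F x'" if "x' \<in> ?D" for x'
      using am(2)[OF that] unfolding vk inner_add_left inner_scaleR_left by linarith
  qed
  \<comment> \<open>The subproblem is solved in the shifted variable; undoing the shift moves the
    evaluation point to \<open>z + zbar\<close>, and the update of \<open>y\<close> is precisely the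
    resulting subgradient.\<close>
  have z_sub: "subgradient ?E ?G (z (k + 1) + zbar (k + 1)) (y (k + 1))" if k: "k \<ge> 1" for k
  proof -
    define c where "c = - y k - ((1 - lams k) * \<alpha>s k) *\<^sub>R (y k - y (k - 1) + \<gamma> *\<^sub>R (z k - z (k - 1)))"
    define b where "b = lams k *\<^sub>R L (x (k + 1)) + (1 - lams k) *\<^sub>R z k"
    have zk: "z (k + 1) = (ARG_MIN (\<lambda>u. g (u + zbar (k + 1)) + ereal (c \<bullet> u)
        + ereal (\<gamma> / 2 * (norm (u - b))\<^sup>2)) u. True)"
      using z_step k unfolding c_def b_def diff_diff_eq[symmetric] by blast
    have one: "1 * norm u \<le> norm u" for u :: 'g by simp
    note am = arg_min_quadratic_subgradient[OF Gamma_class_translate[OF g] bounded_linear_inner_right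
        bounded_linear_ident zero_less_one one \<gamma> zk]
    have yk: "y (k + 1) = - (c + \<gamma> *\<^sub>R (z (k + 1) - b))"
      using y_step k unfolding c_def b_def by (simp add: algebra_simps)
    have dom: "z (k + 1) + zbar (k + 1) \<in> ?E" using am(1) by (simp add: eff_dom_def)
    moreover have "?G (z (k + 1) + zbar (k + 1)) + y (k + 1) \<bullet> (q - (z (k + 1) + zbar (k + 1))) \<le> ?G q"
      if "q \<in> ?E" for q
    proof -
      have "q - zbar (k + 1) \<in> eff_dom (\<lambda>w. g (w + zbar (k + 1)))" using that by (simp add: eff_dom_def)
      from am(2)[OF this] have "?G (z (k + 1) + zbar (k + 1)) - c \<bullet> (q - zbar (k + 1) - z (k + 1))
          - \<gamma> * ((z (k + 1) - b) \<bullet> (q - zbar (k + 1) - z (k + 1))) \<le> ?G q" by simp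
      moreover have "q - (z (k + 1) + zbar (k + 1)) = q - zbar (k + 1) - z (k + 1)" by simp
      ultimately show ?thesis
        unfolding yk by (simp only: inner_minus_left inner_add_left inner_scaleR_left)
    qed
    ultimately show ?thesis by (simp add: subgradient_def)
  qed
  \<comment> \<open>The offsets align the start: the subgradient property of \<open>y\<close> begins
    at index 2, \<open>v\<close> of index 2 belongs to \<open>x\<close> of index 3, and the inertial
    increment at index 2 reaches back to \<open>w\<close> of index 1. The bounds on the parameters
    also hold from index 2 on.\<close>
  define X where "X n = x (n + 3)" for n
  define Y where "Y n = y (n + 2)" for n
  define V where "V n = v (n + 2)" for n
  define Q where "Q n = z (n + 2) + zbar (n + 2)" for n
  define W where "W n = w (n + 1)" for n
  define a where "a n = \<alpha>s (n + 2)" for n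
  define l where "l n = lams (n + 2)" for n
  have inertia: "\<gamma> *\<^sub>R zbar (n + 2) = a n *\<^sub>R (W (Suc n) - W n)" for n
    using zbar_eq[of "n + 1"] by (simp add: a_def W_def eval_nat_numeral)
  have V_eq: "V n = Y n + \<gamma> *\<^sub>R (L (X n) - Q n)" for n
  proof -
    have "V n = Y n + \<gamma> *\<^sub>R (L (X n) - z (n + 2)) - a n *\<^sub>R (W (Suc n) - W n)"
      using v_eq[of "n + 2"] by (simp add: V_def Y_def X_def a_def W_def eval_nat_numeral)
    then show ?thesis unfolding inertia[symmetric] Q_def by (simp add: algebra_simps)
  qed
  interpret inertial_splitting ?D ?F ?E ?G L \<theta> \<gamma> \<alpha> \<delta> \<sigma> lam X Q Y V W a l
  proof unfold_locales
    show "closed_convex ?D ?F" "closed_convex ?E ?G" using Gamma_class_closed_convex f g by auto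
    show "0 < \<theta>" "\<theta> * norm u \<le> norm (L u)" for u by (fact \<theta>)+
    show "0 < \<gamma>" "0 < \<delta>" "0 < \<sigma>" "0 < lam" "\<alpha> < 1" using assms by auto
    show "0 \<le> a n" "a n \<le> \<alpha>" for n using assms(9) by (auto simp: a_def)
    show "incseq a" using assms(8) by (auto simp: incseq_def a_def mono_on_def)
    show "lam \<le> l n" "l n \<le> 2 * ((\<delta> - \<alpha> * (\<alpha> * (1 + \<alpha>) + \<alpha> * \<delta> + \<sigma>))
        / (\<delta> * (1 + \<alpha> * (1 + \<alpha>) + \<alpha> * \<delta> + \<sigma>)))" for n
      using assms(15)[rule_format, of "n + 2"] unfolding l_def by simp_all
    show "X n \<in> ?D" for n using x_dom[of "n + 2"] by (simp add: X_def eval_nat_numeral)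
    show "?F (X n) - V n \<bullet> L (x' - X n) \<le> ?F x'" if "x' \<in> ?D" for n x'
      using x_sub[of "n + 2" x'] that by (simp add: X_def V_def eval_nat_numeral)
    show "subgradient ?E ?G (Q n) (Y n)" for n
      using z_sub[of "n + 1"] by (simp add: Q_def Y_def eval_nat_numeral)
    show "V n = Y n + \<gamma> *\<^sub>R (L (X n) - Q n)" for n by (rule V_eq)
    show "W (Suc n) + a n *\<^sub>R (W (Suc n) - W n) = Y n + \<gamma> *\<^sub>R Q n" for n
      unfolding inertia[symmetric]
      by (simp add: W_def w_def Y_def Q_def eval_nat_numeral scaleR_add_right)
    show "W (Suc (Suc n)) = W (Suc n) + a n *\<^sub>R (W (Suc n) - W n) + l n *\<^sub>R (V n - Y n)" for n
    proof -
      have "W (Suc (Suc n)) = W (Suc n) + (\<gamma> * l n) *\<^sub>R (L (X n) - z (n + 2))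
          + ((1 - l n) * a n) *\<^sub>R (W (Suc n) - W n)"
        using w_next[of "n + 2"] by (simp add: W_def X_def l_def a_def eval_nat_numeral)
      moreover have VY: "V n - Y n = \<gamma> *\<^sub>R (L (X n) - z (n + 2)) - a n *\<^sub>R (W (Suc n) - W n)"
        unfolding inertia[symmetric] V_eq Q_def by (simp add: algebra_simps)
      ultimately show ?thesis unfolding VY by (simp add: algebra_simps)
    qed
    show "\<exists>xs vs. kkt_pair ?D ?F ?E ?G L xs vs" using kkt_ex by blast
  qed
  obtain xb vb where k: "kkt_pair ?D ?F ?E ?G L xb vb"
    and Xw: "weakly_converges X xb" and Yw: "weakly_converges Y vb"
    using weak_convergence by blast
  note opt = kkt_pair_optimal[OF f g L k]
  have zbar0: "(\<lambda>n. zbar (n + 2)) \<longlonglongrightarrow> 0"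
  proof -
    have "zbar (n + 2) = (1 / \<gamma>) *\<^sub>R (a n *\<^sub>R (W (Suc n) - W n))" for n
      unfolding inertia[symmetric] using \<gamma> by simp
    moreover have "(\<lambda>n. (1 / \<gamma>) *\<^sub>R (a n *\<^sub>R (W (Suc n) - W n))) \<longlonglongrightarrow> (1 / \<gamma>) *\<^sub>R 0"
      by (intro tendsto_intros inertia_tendsto)
    ultimately show ?thesis by simp
  qed
  have Lxz: "(\<lambda>n. L (X n) - z (n + 2)) \<longlonglongrightarrow> 0"
  proof -
    have "L (X n) - z (n + 2) = (1 / \<gamma>) *\<^sub>R (V n - Y n) + zbar (n + 2)" for n
      by (simp add: LX_eq) (simp add: Q_def)
    moreover have "(\<lambda>n. (1 / \<gamma>) *\<^sub>R (V n - Y n) + zbar (n + 2)) \<longlonglongrightarrow> (1 / \<gamma>) *\<^sub>R 0 + 0"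
      by (intro tendsto_intros residual_tendsto zbar0)
    ultimately show ?thesis by simp
  qed
  have zw: "weakly_converges (\<lambda>n. z (n + 2)) (L xb)"
    using weakly_converges_add_null[OF weakly_converges_bounded_linear[OF L Xw] tendsto_minus[OF Lxz, simplified minus_zero]]
    by simp
  have Vw: "weakly_converges V vb"
    using weakly_converges_add_null[OF Yw residual_tendsto] by simp
  have val_seq: "f (X n) + g (Q n) = ereal (?F (X n) + ?G (Q n))" for n
    by (subst Gamma_class_finite[OF f XD], subst Gamma_class_finite[OF g QE]) simp
  \<comment> \<open>Fenchel-Young equality at both inclusions turns the dual value into the primal
    expression plus the cross term, so one limit serves both objectives.\<close>
  have dual_seq: "- conj_fun f (- adjoint L (V n)) - conj_fun g (Y n)
      = ereal (?F (X n) + ?G (Q n) + (V n \<bullet> L (X n) - Y n \<bullet> Q n))" for n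
    using conj_fun_subgradient[OF f kkt_pair_subdiff[OF L XD sub_F]] conj_fun_subgradient[OF g sub_G]
    by (simp add: adjoint_works_complete[OF L])
  have dual_lim: "(\<lambda>n. ?F (X n) + ?G (Q n) + (V n \<bullet> L (X n) - Y n \<bullet> Q n)) \<longlonglongrightarrow> ?F xb + ?G (L xb) + 0"
    by (intro tendsto_add value_tendsto[OF k] cross_term_tendsto)
  show ?thesis
  proof (rule exI[of _ xb], rule exI[of _ vb], intro conjI)
    show "- adjoint L vb \<in> subdiff f xb"
      using k by (intro subgradient_imp_subdiff[OF f] kkt_pair_subdiff[OF L]) (auto simp: kkt_pair_def)
    show "vb \<in> subdiff g (L xb)"
      using k by (intro subgradient_imp_subdiff[OF g]) (simp add: kkt_pair_def)
    show "primal_sol f g L xb" "dual_sol f g L vb" "primal_val f g L = dual_val f g L"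
      using opt by simp_all
    show "weakly_converges x xb"
      by (rule weakly_converges_offset[of _ 3]) (use Xw in \<open>simp add: X_def[abs_def]\<close>)
    show "zbar \<longlonglongrightarrow> 0" using zbar0 by (rule LIMSEQ_offset)
    show "weakly_converges z (L xb)" using zw by (rule weakly_converges_offset)
    show "(\<lambda>k. L (x (k + 1)) - z k) \<longlonglongrightarrow> 0"
      by (rule LIMSEQ_offset[of _ 2]) (use Lxz in \<open>simp add: X_def eval_nat_numeral\<close>)
    show "weakly_converges y vb"
      by (rule weakly_converges_offset[of _ 2]) (use Yw in \<open>simp add: Y_def[abs_def]\<close>)
    show "weakly_converges v vb"
      by (rule weakly_converges_offset[of _ 2]) (use Vw in \<open>simp add: V_def[abs_def]\<close>)
    show "uniformly_convex_fun (conj_fun g) \<longrightarrow> (\<exists>d. (\<forall>w. dual_sol f g L w \<longleftrightarrow> w = d) \<and> y \<longlonglongrightarrow> d)"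
    proof
      assume uc: "uniformly_convex_fun (conj_fun g)"
      note sc = uniformly_convex_conj_strong_convergence[OF f g L k uc sub_G gap_Y_tendsto[OF k]]
      have "y \<longlonglongrightarrow> vb" by (rule LIMSEQ_offset[of _ 2]) (use sc(2) in \<open>simp add: Y_def[abs_def]\<close>)
      with sc(1) show "\<exists>d. (\<forall>w. dual_sol f g L w \<longleftrightarrow> w = d) \<and> y \<longlonglongrightarrow> d" by blast
    qed
    show "(\<lambda>k. f (x (k + 1)) + g (z k + zbar k)) \<longlonglongrightarrow> primal_val f g L"
    proof (rule LIMSEQ_offset[of _ 2])
      have "(\<lambda>n. f (X n) + g (Q n)) \<longlonglongrightarrow> primal_val f g L"
        unfolding opt(1) val_seq using value_tendsto[OF k] by simp
      then show "(\<lambda>n. f (x (n + 2 + 1)) + g (z (n + 2) + zbar (n + 2))) \<longlonglongrightarrow> primal_val f g L"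
        by (simp add: X_def Q_def eval_nat_numeral)
    qed
    show "(\<lambda>k. - conj_fun f (- adjoint L (v k)) - conj_fun g (y k)) \<longlonglongrightarrow> dual_val f g L"
    proof (rule LIMSEQ_offset[of _ 2])
      have "(\<lambda>n. - conj_fun f (- adjoint L (V n)) - conj_fun g (Y n)) \<longlonglongrightarrow> dual_val f g L"
        unfolding opt(2) dual_seq using dual_lim by simp
      then show "(\<lambda>n. - conj_fun f (- adjoint L (v (n + 2))) - conj_fun g (y (n + 2))) \<longlonglongrightarrow> dual_val f g L"
        by (simp add: V_def Y_def)
    qed
  qed
qed

end
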